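(* Let $n\ge 2$ and $q\ge 0$. For each partition $\lambda\vdash n$ of length $q+1$ with no part equal to $1$ or $n$, let $V(\lambda)\subseteq \widetilde H_q(X(n),\mathbb Z)$ be the $\mathbb Z$-span of the (classes of the) oriented facets of shape $\lambda$. Then $V(\lambda)$ is a $\mathbb ZS_n$-submodule and there is an isomorphism of $\mathbb ZS_n$-modules $$V(\lambda)\cong V\uparrow_{N_\lambda}^{S_n},$$ and consequently $$\widetilde H_q(X(n),\mathbb Z)\cong\bigoplus_{\lambda} V\uparrow_{N_\lambda}^{S_n},$$ the sum running over all partitions $\lambda\vdash n$ of length $q+1$ having no parts of size $1$ or $n$.
   Context: $X(n)$ ($n\ge 2$) is the simplicial complex whose vertices are the proper non-empty subsets of $[n]=\{1,\dots,n\}$ and whose $q$-faces are sets of $q+1$ pairwise disjoint proper non-empty subsets of $[n]$; its facets are the partitions of $[n]$ into at least two blocks. The reduced homology $\widetilde H_q(X(n),\mathbb Z)$ is free abelian with basis in bijection with the facets $x_0\ldots x_q$ all of whose blocks have size $\ge 2$. Totally order the vertices by decreasing size, and lexicographically among subsets of equal size; an oriented $q$-face is written $x_0x_1\ldots x_q$ with $x_0<\dots<x_q$ in this order. $S_n$ acts on chains by $g\cdot x_0\ldots x_q=\operatorname{sgn}(\pi)\,y_0\ldots y_q$ where $(gx_0)\ldots(gx_q)=y_{\pi(0)}\ldots y_{\pi(q)}$ with $y_0\ldots y_q$ oriented; this induces an action on homology. The shape of a facet $x_0\ldots x_q$ is the partition $(|x_0|,\dots,|x_q|)\vdash n$. For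 $\lambda=(\lambda_0,\dots,\lambda_q)\vdash n$, let $x_0=\{1,\dots,\lambda_0\}$, $x_1=\{\lambda_0+1,\dots,\lambda_0+\lambda_1\}$, etc., be the minimal oriented face of shape $\lambda$; $S_\lambda\cong S_{\lambda_0}\times\cdots\times S_{\lambda_q}$ is the Young subgroup permuting each $x_i$ within itself, and $N_\lambda$ its normaliser in $S_n$. Writing $\lambda=(\mu_1^{a_1},\dots,\mu_r^{a_r})$ with distinct part sizes $\mu_j$ of multiplicity $a_j$, each $g\in N_\lambda$ permutes the blocks $x_0,\dots,x_q$ (blocks of equal size among themselves), giving a homomorphism $N_\lambda\to N_\lambda/S_\lambda\cong S_{a_1}\times\cdots\times S_{a_r}$, $g\mapsto\bar g$, with $g\cdot x_0\ldots x_q=x_{\bar g0}\ldots x_{\bar gq}$ as sets; $\operatorname{sgn}(\bar g)$ is the sign of $\bar g$ as a permutation of $\{0,\dots,q\}$. $V=\mathbb Z v$ is the rank-one $\mathbb ZN_\lambda$-module with $g\cdot v=\operatorname{sgn}(\bar g)v$, and $V\uparrow_{N_\lambda}^{S_n}$ is the induced module. *)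

theory Defs
  imports "HOL-Combinatorics.Permutations" "HOL-Library.Function_Algebras"
begin

definition vert :: "nat \<Rightarrow> nat set \<Rightarrow> bool" where
  "vert n A \<longleftrightarrow> A \<subseteq> {1..n} \<and> A \<noteq> {} \<and> A \<noteq> {1..n}"

definition face :: "nat \<Rightarrow> nat \<Rightarrow> nat set set \<Rightarrow> bool" where
  "face n q \<sigma> \<longleftrightarrow> card \<sigma> = Suc q \<and> (\<forall>A\<in>\<sigma>. vert n A) \<and> pairwise disjnt \<sigma>"

definition faces :: "nat \<Rightarrow> nat \<Rightarrow> nat set set set" where
  "faces n q = {\<sigma>. face n q \<sigma>}"

definition vless :: "nat set \<Rightarrow> nat set \<Rightarrow> bool" where
  "vless A B \<longleftrightarrow> card A > card B \<or>
     (card A = card B \<and> ord_class.lexordp (sorted_list_of_set A) (sorted_list_of_set B))"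

definition olist :: "nat set set \<Rightarrow> nat set list" where
  "olist \<sigma> = (THE xs. set xs = \<sigma> \<and> sorted_wrt vless xs)"

definition tperm :: "nat set list \<Rightarrow> nat \<Rightarrow> nat" where
  "tperm ys i = (if i < length ys
     then (THE j. j < length ys \<and> olist (set ys) ! j = ys ! i) else i)"

definition tsign :: "nat set list \<Rightarrow> int" where
  "tsign ys = sign (tperm ys)"

text \<open>Integral chains are functions from faces to int; the chain y_0 ... y_q for a
  list of distinct vertices equals sgn(pi) times the oriented face.\<close>
definition ochain :: "nat set list \<Rightarrow> nat set set \<Rightarrow> int" where
  "ochain ys = (\<lambda>\<tau>. if \<tau> = set ys then tsign ys else 0)"

definition chains :: "nat \<Rightarrow> nat \<Rightarrow> (nat set set \<Rightarrow> int) set" where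
  "chains n q = {c. \<forall>\<sigma>. c \<sigma> \<noteq> 0 \<longrightarrow> face n q \<sigma>}"

definition inc :: "nat set set \<Rightarrow> nat set set \<Rightarrow> int" where
  "inc \<sigma> \<tau> = (\<Sum>i<card \<sigma>. if \<tau> = \<sigma> - {olist \<sigma> ! i} then (-1) ^ i else 0)"

definition bd :: "nat \<Rightarrow> nat \<Rightarrow> (nat set set \<Rightarrow> int) \<Rightarrow> (nat set set \<Rightarrow> int)" where
  "bd n q c = (\<lambda>\<tau>. \<Sum>\<sigma>\<in>faces n q. c \<sigma> * inc \<sigma> \<tau>)"

definition cycles :: "nat \<Rightarrow> nat \<Rightarrow> (nat set set \<Rightarrow> int) set" where
  "cycles n q = {c \<in> chains n q.
     (if q = 0 then (\<Sum>\<sigma>\<in>faces n 0. c \<sigma>) = 0 else bd n q c = (\<lambda>_. 0))}"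

definition bdries :: "nat \<Rightarrow> nat \<Rightarrow> (nat set set \<Rightarrow> int) set" where
  "bdries n q = bd n (Suc q) ` chains n (Suc q)"

definition act :: "nat \<Rightarrow> nat \<Rightarrow> (nat \<Rightarrow> nat) \<Rightarrow> (nat set set \<Rightarrow> int) \<Rightarrow> (nat set set \<Rightarrow> int)" where
  "act n q g c = (\<lambda>\<tau>. \<Sum>\<sigma>\<in>faces n q. c \<sigma> * ochain (map ((`) g) (olist \<sigma>)) \<tau>)"

text \<open>The cycle representing the homology class of an oriented facet x_0...x_q
  (all blocks of size >= 2): the join (x_0 - {a_0}) * ... * (x_q - {a_q}),
  a_i = min x_i; its coefficient on the facet x_0...x_q is 1.\<close>
definition zeta :: "nat set list \<Rightarrow> nat set set \<Rightarrow> int" where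
  "zeta xs = (\<lambda>\<tau>. \<Sum>S\<in>Pow {..<length xs}. (-1) ^ card S *
      ochain (map (\<lambda>i. if i \<in> S then {Min (xs ! i)} else xs ! i) [0..<length xs]) \<tau>)"

definition facets_shape :: "nat \<Rightarrow> nat list \<Rightarrow> nat set set set" where
  "facets_shape n lam = {\<sigma>. face n (length lam - 1) \<sigma> \<and> \<Union>\<sigma> = {1..n}
      \<and> map card (olist \<sigma>) = lam}"

text \<open>V(lambda), represented by its full preimage in the cycles: the Z-span of the
  classes of facets of shape lambda plus all boundaries.\<close>
definition Vset :: "nat \<Rightarrow> nat list \<Rightarrow> (nat set set \<Rightarrow> int) set" where
  "Vset n lam = {(\<lambda>\<tau>. (\<Sum>\<sigma>\<in>facets_shape n lam. k \<sigma> * zeta (olist \<sigma>) \<tau>) + b \<tau>) | k b.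
      b \<in> bdries n (length lam - 1)}"

definition Parts :: "nat \<Rightarrow> nat \<Rightarrow> nat list set" where
  "Parts n q = {lam. length lam = Suc q \<and> sorted (rev lam) \<and> sum_list lam = n
      \<and> (\<forall>p\<in>set lam. p > 0 \<and> p \<noteq> 1 \<and> p \<noteq> n)}"

text \<open>Blocks x_i of the minimal oriented face of shape lambda.\<close>
definition blk :: "nat list \<Rightarrow> nat \<Rightarrow> nat set" where
  "blk lam i = {sum_list (take i lam) + 1 .. sum_list (take (Suc i) lam)}"

definition Young :: "nat \<Rightarrow> nat list \<Rightarrow> (nat \<Rightarrow> nat) set" where
  "Young n lam = {h. h permutes {1..n} \<and> (\<forall>i<length lam. h ` blk lam i = blk lam i)}"

definition Norm :: "nat \<Rightarrow> nat list \<Rightarrow> (nat \<Rightarrow> nat) set" where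
  "Norm n lam = {g. g permutes {1..n} \<and> (\<lambda>h. g \<circ> h \<circ> inv g) ` Young n lam = Young n lam}"

definition gbar :: "nat list \<Rightarrow> (nat \<Rightarrow> nat) \<Rightarrow> nat \<Rightarrow> nat" where
  "gbar lam g i = (if i < length lam
     then (THE j. j < length lam \<and> g ` blk lam i = blk lam j) else i)"

text \<open>Induced module V up from N_lambda to S_n, realised as functions f : S_n -> Z
  with f(g h) = sgn(hbar) f(g) for h in N_lambda; (k . f)(g) = f(k^-1 g).\<close>
definition Ind :: "nat \<Rightarrow> nat list \<Rightarrow> ((nat \<Rightarrow> nat) \<Rightarrow> int) set" where
  "Ind n lam = {f. (\<forall>g. f g \<noteq> 0 \<longrightarrow> g permutes {1..n}) \<and>
      (\<forall>g h. g permutes {1..n} \<and> h \<in> Norm n lam \<longrightarrow> f (g \<circ> h) = sign (gbar lam h) * f g)}"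

definition ind_act :: "(nat \<Rightarrow> nat) \<Rightarrow> ((nat \<Rightarrow> nat) \<Rightarrow> int) \<Rightarrow> ((nat \<Rightarrow> nat) \<Rightarrow> int)" where
  "ind_act k f = (\<lambda>g. f (inv k \<circ> g))"

definition DSum :: "nat \<Rightarrow> nat \<Rightarrow> (nat list \<Rightarrow> (nat \<Rightarrow> nat) \<Rightarrow> int) set" where
  "DSum n q = {F. (\<forall>lam\<in>Parts n q. F lam \<in> Ind n lam) \<and> (\<forall>lam. lam \<notin> Parts n q \<longrightarrow> F lam = (\<lambda>_. 0))}"

definition dsum_act :: "(nat \<Rightarrow> nat) \<Rightarrow> (nat list \<Rightarrow> (nat \<Rightarrow> nat) \<Rightarrow> int) \<Rightarrow> (nat list \<Rightarrow> (nat \<Rightarrow> nat) \<Rightarrow> int)" where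
  "dsum_act k F = (\<lambda>lam. ind_act k (F lam))"

text \<open>phi induces an isomorphism of Z S_n-modules  Z / K  ~=  M  (Z a set of q-cycles
  stable under the action, K the boundaries): phi is additive and S_n-equivariant
  on Z, maps Z onto M, and has kernel exactly K.\<close>
definition equiv_quot_iso ::
  "nat \<Rightarrow> nat \<Rightarrow> (nat set set \<Rightarrow> int) set \<Rightarrow> (nat set set \<Rightarrow> int) set \<Rightarrow>
   ('m::{zero,plus}) set \<Rightarrow> ((nat \<Rightarrow> nat) \<Rightarrow> 'm \<Rightarrow> 'm) \<Rightarrow> ((nat set set \<Rightarrow> int) \<Rightarrow> 'm) \<Rightarrow> bool" where
  "equiv_quot_iso n q Z K M actM phi \<longleftrightarrow>
     phi ` Z = M \<and>
     (\<forall>c\<in>Z. \<forall>d\<in>Z. phi (c + d) = phi c + phi d) \<and>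
     (\<forall>c\<in>Z. phi c = 0 \<longleftrightarrow> c \<in> K) \<and>
     (\<forall>g c. g permutes {1..n} \<and> c \<in> Z \<longrightarrow> phi (act n q g c) = actM g (phi c))"

end

theory Submission
  imports Defs
begin

text \<open>
  A cycle is determined modulo boundaries by its coefficients on the facets without singleton
  blocks: such a coefficient vanishes on boundaries, since nothing contains a facet; conversely,
  a cycle vanishing on all these facets is a boundary. For the latter, group the faces by
  their non-singleton blocks. The faces with given non-singleton blocks form a full simplex on
  the uncovered points, which can be coned off from the least uncovered point, and an induction
  on the number of non-singleton blocks finishes the argument. The join cycles show that these
  coefficients can be prescribed arbitrarily, so the homology is the signed permutation module on
  the facets without singletons. Its orbits are given by the shapes, the stabiliser of the
  minimal face of shape \<open>\<lambda>\<close> is the normaliser of the Young subgroup, and it acts there through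
  the sign of the block permutation. The isomorphism evaluates a cycle on the translates of the
  minimal face, with the sign that reorders the translated blocks.
\<close>

section \<open>Signs of vertex orderings\<close>

text \<open>The obstacle is the bookkeeping of signs. \<open>olist\<close>, \<open>tperm\<close> and
  \<open>inc\<close> refer to positions in a sorted list, and positions shift whenever a block is
  added, deleted, shrunk or moved. Signs are therefore rewritten as products over pairs of vertices
  (\<open>esgn\<close>, \<open>ssgn\<close>, \<open>isgn\<close>), and the boundary is read
  coefficientwise: its value at \<tau> is a sum over the vertices \<open>v\<close> that can be added
  to \<tau>, with sign \<open>ssgn \<tau> v\<close>. The square of the boundary, the cone formula
  and equivariance then reduce to identities for pairs of vertices.

  The induction works because deleting a vertex either keeps the non-singleton blocks or loses one
  of them. On the highest level of a cycle only deletions of the first kind are felt, so there the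
  cycle condition is that of separate simplices. The only case without a cone point is an empty
  residual set, and such a face is exactly a facet without singletons.

  No quotient is ever formed: kernels, images and spans are all tested on the coefficients at these
  facets.\<close>

lemma vless_irrefl: "\<not> vless A A"
  by (simp add: vless_def lexordp_irreflexive')

lemma vless_trans: "vless A B \<Longrightarrow> vless B C \<Longrightarrow> vless A C"
  unfolding vless_def by (auto intro: lexordp_trans)

lemma vless_asym: "vless A B \<Longrightarrow> \<not> vless B A"
  using vless_irrefl vless_trans by blast

lemma vless_total:
  assumes "finite A" "finite B" "A \<noteq> B"
  shows "vless A B \<or> vless B A"
proof -
  have "sorted_list_of_set A \<noteq> sorted_list_of_set B"
    using assms by (metis set_sorted_list_of_set)
  then show ?thesis
    unfolding vless_def by (meson lexordp_linear linorder_neqE_nat)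
qed

lemma sorted_vless_distinct: "sorted_wrt vless xs \<Longrightarrow> distinct xs"
  by (induction xs) (auto simp: vless_irrefl)

lemma sorted_vless_unique:
  "sorted_wrt vless xs \<Longrightarrow> sorted_wrt vless ys \<Longrightarrow> set xs = set ys \<Longrightarrow> xs = ys"
proof (induction xs arbitrary: ys)
  case Nil
  then show ?case by simp
next
  case (Cons x xs)
  then obtain y zs where ys: "ys = y # zs"
    by (cases ys) auto
  have "x = y"
    using Cons.prems vless_asym unfolding ys by (metis list.set_intros(1) set_ConsD sorted_wrt.simps(2))
  moreover have "x \<notin> set xs" "x \<notin> set zs"
    using Cons.prems vless_irrefl \<open>x = y\<close> unfolding ys by auto
  then have "set xs = set zs"
    using Cons.prems(3) \<open>x = y\<close> unfolding ys by auto
  ultimately show ?case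
    using Cons unfolding ys by auto
qed

lemma sorted_vless_exists:
  assumes "finite \<sigma>" "\<forall>A\<in>\<sigma>. finite A"
  shows "\<exists>xs. set xs = \<sigma> \<and> sorted_wrt vless xs"
  using assms
proof (induction \<sigma> rule: finite_induct)
  case empty
  then show ?case by simp
next
  case (insert A \<sigma>)
  then obtain xs where xs: "set xs = \<sigma>" "sorted_wrt vless xs"
    by auto
  let ?ys = "filter (\<lambda>B. vless B A) xs @ A # filter (vless A) xs"
  have "set ?ys = insert A \<sigma>"
    using insert xs vless_total by auto
  moreover have "sorted_wrt vless ?ys"
    using xs by (auto simp: sorted_wrt_append sorted_wrt_filter intro: vless_trans)
  ultimately show ?case by blast
qed

lemma olist_props:
  assumes "finite \<sigma>" "\<forall>A\<in>\<sigma>. finite A"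
  shows set_olist: "set (olist \<sigma>) = \<sigma>" and sorted_olist: "sorted_wrt vless (olist \<sigma>)"
proof -
  have "set (olist \<sigma>) = \<sigma> \<and> sorted_wrt vless (olist \<sigma>)"
    unfolding olist_def
    by (rule theI') (metis assms sorted_vless_exists sorted_vless_unique)
  then show "set (olist \<sigma>) = \<sigma>" "sorted_wrt vless (olist \<sigma>)" by auto
qed

lemma olist_eqI: "sorted_wrt vless xs \<Longrightarrow> olist (set xs) = xs"
  unfolding olist_def by (rule the_equality) (auto intro: sorted_vless_unique)

lemma distinct_olist: "finite \<sigma> \<Longrightarrow> \<forall>A\<in>\<sigma>. finite A \<Longrightarrow> distinct (olist \<sigma>)"
  using sorted_olist sorted_vless_distinct by blast

lemma length_olist: "finite \<sigma> \<Longrightarrow> \<forall>A\<in>\<sigma>. finite A \<Longrightarrow> length (olist \<sigma>) = card \<sigma>"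
  using distinct_olist set_olist distinct_card by metis

lemma tperm_eqI:
  assumes ys: "distinct ys" "\<forall>A\<in>set ys. finite A"
    and p: "p permutes {..<length ys}"
    and eq: "\<And>i. i < length ys \<Longrightarrow> olist (set ys) ! p i = ys ! i"
  shows "tperm ys = p"
proof
  fix i
  have len: "length (olist (set ys)) = length ys" and dis: "distinct (olist (set ys))"
    using ys by (simp_all add: length_olist distinct_card distinct_olist)
  show "tperm ys i = p i"
  proof (cases "i < length ys")
    case True
    then have "p i < length ys"
      using permutes_in_image[OF p, of i] by simp
    with True show ?thesis
      unfolding tperm_def using eq[OF True] dis len
      by (auto intro!: the_equality) (metis nth_eq_iff_index_eq)
  next
    case False
    then show ?thesis
      using p by (simp add: tperm_def permutes_def)
  qed
qed

lemma tperm_props: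
  assumes ys: "distinct ys" "\<forall>A\<in>set ys. finite A"
  shows tperm_permutes: "tperm ys permutes {..<length ys}"
    and nth_tperm: "i < length ys \<Longrightarrow> olist (set ys) ! tperm ys i = ys ! i"
proof -
  let ?L = "olist (set ys)"
  have L: "length ?L = length ys" "distinct ?L" "set ?L = set ys"
    using ys by (simp_all add: length_olist distinct_card distinct_olist set_olist)
  have *: "tperm ys i < length ys \<and> ?L ! tperm ys i = ys ! i" if i: "i < length ys" for i
  proof -
    have "ys ! i \<in> set ?L"
      using i L by simp
    then obtain j where j: "j < length ys" "?L ! j = ys ! i"
      using L by (metis in_set_conv_nth)
    have "tperm ys i = j"
      unfolding tperm_def using i j L by (auto intro!: the_equality) (metis nth_eq_iff_index_eq)
    with j show ?thesis by simp
  qed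
  then show "i < length ys \<Longrightarrow> ?L ! tperm ys i = ys ! i" by simp
  have inj: "inj_on (tperm ys) {..<length ys}"
    using * ys(1) by (intro inj_onI) (metis lessThan_iff nth_eq_iff_index_eq)
  have "tperm ys ` {..<length ys} \<subseteq> {..<length ys}"
    using * by auto
  then have "bij_betw (tperm ys) {..<length ys} {..<length ys}"
    using inj by (simp add: bij_betw_def endo_inj_surj)
  then show "tperm ys permutes {..<length ys}"
    by (rule bij_imp_permutes) (simp add: tperm_def)
qed

lemma tsign_compose:
  assumes ys: "distinct ys" "\<forall>A\<in>set ys. finite A"
    and p: "p permutes {..<length ys}" and zs: "length zs = length ys"
    and eq: "\<And>i. i < length ys \<Longrightarrow> zs ! i = ys ! p i"
  shows "tsign zs = sign p * tsign ys"
proof -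
  have lt: "p i < length ys" if "i < length ys" for i
    using that permutes_in_image[OF p, of i] by simp
  have set: "set zs = set ys"
  proof -
    have "set zs = (\<lambda>i. ys ! p i) ` {..<length ys}"
      unfolding set_conv_nth using eq zs by auto
    also have "\<dots> = (!) ys ` (p ` {..<length ys})"
      by (simp add: image_image)
    also have "\<dots> = set ys"
      using permutes_image[OF p] by (auto simp: in_set_conv_nth image_iff)
    finally show ?thesis .
  qed
  then have dz: "distinct zs"
    using ys zs by (metis card_distinct distinct_card)
  have "tperm zs = tperm ys \<circ> p"
  proof (rule tperm_eqI)
    show "tperm ys \<circ> p permutes {..<length zs}"
      using permutes_compose[OF p tperm_permutes[OF ys]] zs by simp
  qed (use dz ys zs set eq lt nth_tperm[OF ys] in auto)
  moreover have "permutation p" "permutation (tperm ys)"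
    using p tperm_permutes[OF ys] by (auto intro: permutation_permutes[THEN iffD2])
  ultimately show ?thesis
    unfolding tsign_def by (simp add: sign_compose)
qed

lemma tsign_sorted:
  assumes "sorted_wrt vless xs" "\<forall>A\<in>set xs. finite A"
  shows "tsign xs = 1"
proof -
  have "tperm xs = id"
    using assms by (intro tperm_eqI) (auto simp: sorted_vless_distinct olist_eqI permutes_id)
  then show ?thesis
    by (simp add: tsign_def sign_id)
qed

lemma tsign_square: "tsign ys * tsign ys = 1"
  unfolding tsign_def by (rule sign_idempotent)

text \<open>The permutation \<open>tperm ys\<close> that leads from the sorted list to
  \<open>ys\<close> also leads from the \<open>f\<close>-image of the sorted list to the
  \<open>f\<close>-image of \<open>ys\<close>, so its sign splits off. This is what makes
  \<open>eps\<close> a cocycle later.\<close>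

lemma tsign_map:
  assumes ys: "distinct ys" "\<forall>A\<in>set ys. finite A"
    and f: "inj_on f (set ys)" "\<And>A. A \<in> set ys \<Longrightarrow> finite (f A)"
  shows "tsign (map f ys) = tsign ys * tsign (map f (olist (set ys)))"
  unfolding tsign_def[of ys]
proof (rule tsign_compose)
  have L: "length (olist (set ys)) = length ys" "set (olist (set ys)) = set ys" "distinct (olist (set ys))"
    using ys by (simp_all add: length_olist distinct_card set_olist distinct_olist)
  show "distinct (map f (olist (set ys)))" "\<forall>A\<in>set (map f (olist (set ys))). finite A"
    using L f by (auto simp: distinct_map)
  show "tperm ys permutes {..<length (map f (olist (set ys)))}"
    using tperm_permutes[OF ys] L by simp
  fix i assume "i < length (map f (olist (set ys)))"
  then have i: "i < length ys" using L by simp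
  then have "tperm ys i < length ys"
    using permutes_in_image[OF tperm_permutes[OF ys], of i] by simp
  then show "map f ys ! i = map f (olist (set ys)) ! tperm ys i"
    using i L nth_tperm[OF ys i] by simp
qed (use ys in \<open>simp add: length_olist distinct_card\<close>)

section \<open>Signs as products over pairs of vertices\<close>

definition esgn :: "nat set \<Rightarrow> nat set \<Rightarrow> int" where
  "esgn v w = (if vless v w then -1 else 1)"

text \<open>For finite \<sigma> this is -1 to the number of elements of \<sigma> that precede
  \<open>v\<close>. As \<open>esgn v v = 1\<close>, it does not matter whether \<open>v\<close>
  itself belongs to \<sigma>, so one sign serves both for deleting \<open>v\<close> and for adding
  it.\<close>

definition ssgn :: "nat set set \<Rightarrow> nat set \<Rightarrow> int" where
  "ssgn \<sigma> v = (\<Prod>w\<in>\<sigma>. esgn w v)"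

text \<open>For a distinct list, the parity of the number of inversions: each entry is compared with
  those after it.\<close>

fun isgn :: "nat set list \<Rightarrow> int" where
  "isgn [] = 1"
| "isgn (y # ys) = ssgn (set ys) y * isgn ys"

lemma esgn_self [simp]: "esgn v v = 1"
  by (simp add: esgn_def vless_irrefl)

lemma esgn_square [simp]: "esgn v w * esgn v w = 1"
  by (simp add: esgn_def)

lemma esgn_swap: "finite v \<Longrightarrow> finite w \<Longrightarrow> v \<noteq> w \<Longrightarrow> esgn v w = - esgn w v"
  using vless_total[of v w] vless_asym by (auto simp: esgn_def)

lemma ssgn_insert: "finite \<sigma> \<Longrightarrow> x \<notin> \<sigma> \<Longrightarrow> ssgn (insert x \<sigma>) v = esgn x v * ssgn \<sigma> v"
  by (simp add: ssgn_def)

lemma ssgn_square [simp]: "ssgn \<sigma> v * ssgn \<sigma> v = 1"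
  unfolding ssgn_def by (simp flip: prod.distrib)

lemma ssgn_insert_self: "ssgn (insert v \<sigma>) v = ssgn \<sigma> v"
proof (cases "finite \<sigma> \<and> v \<notin> \<sigma>")
  case True
  then show ?thesis by (simp add: ssgn_insert)
next
  case False
  then show ?thesis by (auto simp: ssgn_def insert_absorb)
qed

lemma isgn_swap:
  assumes "distinct (p @ a # b # zs)" "finite a" "finite b"
  shows "isgn (p @ b # a # zs) = - isgn (p @ a # b # zs)"
  using assms
proof (induction p)
  case Nil
  then show ?case
    using esgn_swap[of a b] by (simp add: ssgn_insert)
next
  case (Cons x p)
  have "set (p @ b # a # zs) = set (p @ a # b # zs)" by auto
  with Cons show ?case by (simp only: append_Cons isgn.simps) simp
qed

lemma isgn_sorted: "sorted_wrt vless xs \<Longrightarrow> isgn xs = 1"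
  by (induction xs) (auto simp: ssgn_def esgn_def vless_asym intro!: prod.neutral)

lemma tsign_swap:
  assumes d: "distinct (p @ a # b # zs)" and f: "\<forall>A\<in>set (p @ a # b # zs). finite A"
  shows "tsign (p @ b # a # zs) = - tsign (p @ a # b # zs)"
proof -
  let ?k = "length p"
  have "tsign (p @ b # a # zs) = sign (transpose ?k (Suc ?k)) * tsign (p @ a # b # zs)"
  proof (rule tsign_compose[OF d f])
    show "transpose ?k (Suc ?k) permutes {..<length (p @ a # b # zs)}"
      by (rule permutes_swap_id) auto
    show "(p @ b # a # zs) ! i = (p @ a # b # zs) ! transpose ?k (Suc ?k) i" for i
    proof -
      consider "i < ?k" | "i = ?k" | "i = Suc ?k" | j where "i = ?k + Suc (Suc j)"
        by atomize_elim presburger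
      then show ?thesis
        by cases (auto simp: nth_append transpose_def)
    qed
  qed simp
  then show ?thesis by (simp add: sign_swap_id)
qed

text \<open>One insertion step of a sort. An adjacent exchange negates both signs, so their product
  survives; the prefix \<open>p\<close> absorbs the entries that \<open>y\<close> has already passed
  on its way to the right.\<close>

lemma tsign_isgn_bubble:
  assumes "sorted_wrt vless L" "distinct (p @ y # L)" "\<forall>A\<in>set (p @ y # L). finite A"
  shows "\<exists>M. sorted_wrt vless M \<and> set M = insert y (set L) \<and>
    tsign (p @ y # L) * isgn (p @ y # L) = tsign (p @ M) * isgn (p @ M)"
  using assms
proof (induction L arbitrary: p)
  case Nil
  then show ?case by (intro exI[of _ "[y]"]) simp
next
  case (Cons l L)
  show ?case
  proof (cases "vless y l")
    case True
    then show ?thesis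
      using Cons.prems by (intro exI[of _ "y # l # L"]) (auto intro: vless_trans)
  next
    case False
    then have ly: "vless l y"
      using vless_total[of y l] Cons.prems by auto
    obtain M where M: "sorted_wrt vless M" "set M = insert y (set L)"
      "tsign ((p @ [l]) @ y # L) * isgn ((p @ [l]) @ y # L) = tsign ((p @ [l]) @ M) * isgn ((p @ [l]) @ M)"
      using Cons.IH[of "p @ [l]"] Cons.prems by auto
    have "tsign (p @ y # l # L) * isgn (p @ y # l # L) = tsign (p @ l # y # L) * isgn (p @ l # y # L)"
      using tsign_swap[of p y l L] isgn_swap[of p y l L] Cons.prems by simp
    with M show ?thesis
      using Cons.prems ly by (intro exI[of _ "l # M"]) auto
  qed
qed

lemma tsign_isgn_sort:
  assumes "distinct (p @ ys)" "\<forall>A\<in>set (p @ ys). finite A"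
  shows "\<exists>M. sorted_wrt vless M \<and> set M = set ys \<and>
    tsign (p @ ys) * isgn (p @ ys) = tsign (p @ M) * isgn (p @ M)"
  using assms
proof (induction ys arbitrary: p)
  case Nil
  then show ?case by auto
next
  case (Cons y ys)
  then obtain L where L: "sorted_wrt vless L" "set L = set ys"
    "tsign ((p @ [y]) @ ys) * isgn ((p @ [y]) @ ys) = tsign ((p @ [y]) @ L) * isgn ((p @ [y]) @ L)"
    using Cons.IH[of "p @ [y]"] by auto
  have "distinct (p @ y # L)"
    using Cons.prems L sorted_vless_distinct by auto
  then obtain M where "sorted_wrt vless M" "set M = insert y (set L)"
    "tsign (p @ y # L) * isgn (p @ y # L) = tsign (p @ M) * isgn (p @ M)"
    using tsign_isgn_bubble[OF L(1), of p y] Cons.prems L by auto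
  with L show ?case by (intro exI[of _ M]) auto
qed

text \<open>Sorting preserves the product of the two signs, and both are 1 on a sorted list.\<close>

lemma tsign_eq_isgn:
  assumes "distinct ys" "\<forall>A\<in>set ys. finite A"
  shows "tsign ys = isgn ys"
proof -
  obtain M where M: "sorted_wrt vless M" "set M = set ys" "tsign ys * isgn ys = tsign M * isgn M"
    using tsign_isgn_sort[of "[]" ys] assms by auto
  then have "tsign ys * isgn ys = 1"
    using assms by (simp add: tsign_sorted isgn_sorted)
  then show ?thesis
    using tsign_square[of ys] by (metis mult.assoc mult.commute mult_1)
qed

text \<open>Each entry of \<open>p\<close> is compared with \<open>v\<close> once in either
  direction, which gives a factor -1; each entry of \<open>z\<close> contributes the same comparison
  twice, which cancels. This yields the alternating boundary signs for lists in any order.\<close>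

lemma isgn_delete:
  assumes "distinct (p @ v # z)" "\<forall>A\<in>set (p @ v # z). finite A"
  shows "isgn (p @ v # z) * ssgn (set (p @ v # z)) v = (-1) ^ length p * isgn (p @ z)"
  using assms
proof (induction p)
  case Nil
  then show ?case by (simp add: ssgn_insert mult.assoc mult.left_commute)
next
  case (Cons x p)
  have "set ((x # p) @ v # z) = insert x (set (p @ v # z))" "set (p @ v # z) = insert v (set (p @ z))"
    by auto
  then have 1: "ssgn (set (p @ v # z)) x = esgn v x * ssgn (set (p @ z)) x"
    and 2: "ssgn (set ((x # p) @ v # z)) v = - esgn v x * ssgn (set (p @ v # z)) v"
    using Cons.prems ssgn_insert[of "set (p @ z)" v x] ssgn_insert[of "set (p @ v # z)" x v]
      esgn_swap[of x v] by simp_all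
  have "isgn ((x # p) @ v # z) * ssgn (set ((x # p) @ v # z)) v
    = - (esgn v x * esgn v x) * ssgn (set (p @ z)) x * (isgn (p @ v # z) * ssgn (set (p @ v # z)) v)"
    unfolding 2 by (simp only: append_Cons isgn.simps 1) (simp only: ac_simps mult_minus_left mult_minus_right)
  also have "isgn (p @ v # z) * ssgn (set (p @ v # z)) v = (-1) ^ length p * isgn (p @ z)"
    using Cons by simp
  finally show ?case
    by simp
qed

lemma sorted_vless_below:
  assumes "sorted_wrt vless xs" "i < length xs"
  shows "{w\<in>set xs. vless w (xs ! i)} = set (take i xs)"
proof -
  have "vless (xs ! j) (xs ! i) \<longleftrightarrow> j < i" if "j < length xs" for j
    using assms that vless_asym vless_irrefl
    by (metis linorder_neqE_nat sorted_wrt_nth_less)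
  then have "{w\<in>set xs. vless w (xs ! i)} = (!) xs ` {..<i}"
    using assms(2) by (force simp: set_conv_nth)
  also have "\<dots> = set (take i xs)"
    using nth_image[of i xs] assms(2) by (simp add: atLeast0LessThan)
  finally show ?thesis .
qed

lemma ssgn_nth_olist:
  assumes "finite \<sigma>" "\<forall>A\<in>\<sigma>. finite A" "i < card \<sigma>"
  shows "ssgn \<sigma> (olist \<sigma> ! i) = (-1) ^ i"
proof -
  let ?L = "olist \<sigma>"
  have i: "i < length ?L" using assms by (simp add: length_olist)
  have "ssgn \<sigma> (?L ! i) = (-1) ^ card {w\<in>\<sigma>. vless w (?L ! i)}"
    unfolding ssgn_def esgn_def using assms(1) by (simp add: prod.If_cases Int_def)
  also have "{w\<in>\<sigma>. vless w (?L ! i)} = set (take i ?L)"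
    using sorted_vless_below[OF sorted_olist[OF assms(1,2)] i] set_olist[OF assms(1,2)] by simp
  also have "card \<dots> = i"
    using distinct_olist[OF assms(1,2)] i by (simp add: distinct_card)
  finally show ?thesis .
qed

lemma inc_eq:
  assumes "finite \<sigma>" "\<forall>A\<in>\<sigma>. finite A"
  shows "inc \<sigma> \<tau> = (\<Sum>v\<in>\<sigma>. if \<tau> = \<sigma> - {v} then ssgn \<sigma> v else 0)"
proof -
  have "bij_betw ((!) (olist \<sigma>)) {..<card \<sigma>} \<sigma>"
    using bij_betw_nth[OF distinct_olist[OF assms]] assms by (simp add: length_olist set_olist)
  then have "(\<Sum>v\<in>\<sigma>. if \<tau> = \<sigma> - {v} then ssgn \<sigma> v else 0)
     = (\<Sum>i<card \<sigma>. if \<tau> = \<sigma> - {olist \<sigma> ! i} then ssgn \<sigma> (olist \<sigma> ! i) else 0)"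
    by (simp add: sum.reindex_bij_betw[symmetric])
  also have "\<dots> = inc \<sigma> \<tau>"
    unfolding inc_def by (intro sum.cong) (auto simp: ssgn_nth_olist assms)
  finally show ?thesis by simp
qed

section \<open>Chains, cycles and acyclicity away from the big facets\<close>

lemma vert_finite: "vert n A \<Longrightarrow> finite A"
  unfolding vert_def using finite_subset by blast

lemma finite_verts: "finite {A. vert n A}"
  by (rule finite_subset[of _ "Pow {1..n}"]) (auto simp: vert_def)

lemma face_finite: "face n q \<sigma> \<Longrightarrow> finite \<sigma>"
  unfolding face_def by (metis card.infinite nat.distinct(1))

lemma face_blocks_finite: "face n q \<sigma> \<Longrightarrow> \<forall>A\<in>\<sigma>. finite A"
  unfolding face_def using vert_finite by blast

lemma finite_faces: "finite (faces n q)"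
  by (rule finite_subset[of _ "Pow {A. vert n A}"]) (auto simp: faces_def face_def finite_verts)

lemma face_insertD: "face n (Suc q) (insert v \<tau>) \<Longrightarrow> v \<notin> \<tau> \<Longrightarrow> face n q \<tau>"
  using face_finite[of n "Suc q" "insert v \<tau>"]
  by (auto simp: face_def pairwise_insert)

lemma face_insertI:
  assumes f: "face n q \<tau>" and v: "vert n v" "\<And>A. A \<in> \<tau> \<Longrightarrow> disjnt v A"
  shows "face n (Suc q) (insert v \<tau>)"
proof -
  have "v \<notin> \<tau>"
    using v by (auto simp: vert_def disjnt_def)
  then show ?thesis
    using f v face_finite[OF f] by (auto simp: face_def pairwise_insert disjnt_sym)
qed

text \<open>The sum over faces becomes a sum over the vertices to be added. All vertices outside
  \<tau> may be included, since \<open>c\<close> vanishes on \<open>insert v \<tau>\<close> unless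
  this is a face.\<close>

lemma bd_coeff:
  assumes c: "c \<in> chains n q"
  shows "bd n q c \<tau> = (\<Sum>v\<in>{A. vert n A} - \<tau>. c (insert v \<tau>) * ssgn \<tau> v)"
proof -
  let ?V = "{A. vert n A}"
  have "bd n q c \<tau> = (\<Sum>\<sigma>\<in>faces n q. \<Sum>v\<in>?V. if v \<notin> \<tau> \<and> \<sigma> = insert v \<tau> then c \<sigma> * ssgn \<tau> v else 0)"
    unfolding bd_def
  proof (intro sum.cong refl)
    fix \<sigma> assume "\<sigma> \<in> faces n q"
    then have f: "finite \<sigma>" "\<forall>A\<in>\<sigma>. finite A" "\<sigma> \<subseteq> ?V"
      using face_finite face_blocks_finite by (auto simp: faces_def face_def)
    have "c \<sigma> * inc \<sigma> \<tau> = (\<Sum>v\<in>\<sigma>. if \<tau> = \<sigma> - {v} then c \<sigma> * ssgn \<sigma> v else 0)"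
      unfolding inc_eq[OF f(1,2)] sum_distrib_left by (intro sum.cong) auto
    also have "\<dots> = (\<Sum>v\<in>?V. if v \<notin> \<tau> \<and> \<sigma> = insert v \<tau> then c \<sigma> * ssgn \<tau> v else 0)"
    proof (rule sum.mono_neutral_cong_left[OF finite_verts f(3)])
      show "(if \<tau> = \<sigma> - {v} then c \<sigma> * ssgn \<sigma> v else 0)
        = (if v \<notin> \<tau> \<and> \<sigma> = insert v \<tau> then c \<sigma> * ssgn \<tau> v else 0)" if "v \<in> \<sigma>" for v
        using that by (auto simp: ssgn_insert_self insert_absorb)
    qed auto
    finally show "c \<sigma> * inc \<sigma> \<tau> = \<dots>" .
  qed
  also have "\<dots> = (\<Sum>v\<in>?V. \<Sum>\<sigma>\<in>faces n q. if v \<notin> \<tau> \<and> \<sigma> = insert v \<tau> then c \<sigma> * ssgn \<tau> v else 0)"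
    by (rule sum.swap)
  also have "\<dots> = (\<Sum>v\<in>?V. if v \<notin> \<tau> then c (insert v \<tau>) * ssgn \<tau> v else 0)"
  proof (intro sum.cong refl)
    fix v
    show "(\<Sum>\<sigma>\<in>faces n q. if v \<notin> \<tau> \<and> \<sigma> = insert v \<tau> then c \<sigma> * ssgn \<tau> v else 0)
      = (if v \<notin> \<tau> then c (insert v \<tau>) * ssgn \<tau> v else 0)"
      using c finite_faces[of n q] by (auto simp: sum.delta chains_def faces_def)
  qed
  also have "\<dots> = (\<Sum>v\<in>?V - \<tau>. c (insert v \<tau>) * ssgn \<tau> v)"
    by (rule sum.mono_neutral_cong_right) (auto simp: finite_verts)
  finally show ?thesis .
qed

lemma chains_add: "c \<in> chains n q \<Longrightarrow> d \<in> chains n q \<Longrightarrow> (\<lambda>\<tau>. c \<tau> + d \<tau>) \<in> chains n q"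
  unfolding chains_def by (auto dest: spec) (metis add_0)

lemma chains_diff: "c \<in> chains n q \<Longrightarrow> d \<in> chains n q \<Longrightarrow> (\<lambda>\<tau>. c \<tau> - d \<tau>) \<in> chains n q"
  unfolding chains_def by (auto dest: spec) metis

lemma bd_add: "bd n q (\<lambda>\<tau>. c \<tau> + d \<tau>) \<tau> = bd n q c \<tau> + bd n q d \<tau>"
  by (simp add: bd_def ring_distribs sum.distrib)

lemma bd_diff: "bd n q (\<lambda>\<tau>. c \<tau> - d \<tau>) \<tau> = bd n q c \<tau> - bd n q d \<tau>"
  by (simp add: bd_def left_diff_distrib sum_subtractf)

lemma bd_sum: "bd n q (\<lambda>\<tau>. \<Sum>x\<in>X. k x * c x \<tau>) \<tau> = (\<Sum>x\<in>X. k x * bd n q (c x) \<tau>)"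
  unfolding bd_def sum_distrib_left sum_distrib_right
  by (subst sum.swap) (simp add: mult.assoc)

lemma bd_in_chains: "c \<in> chains n (Suc q) \<Longrightarrow> bd n (Suc q) c \<in> chains n q"
  unfolding chains_def[of n q]
proof (intro CollectI allI impI)
  fix \<tau> assume c: "c \<in> chains n (Suc q)" and "bd n (Suc q) c \<tau> \<noteq> 0"
  then obtain v where "v \<notin> \<tau>" "c (insert v \<tau>) \<noteq> 0"
    unfolding bd_coeff[OF c] by (metis (no_types, lifting) DiffD2 mult_zero_left sum.neutral)
  then show "face n q \<tau>"
    using c face_insertD by (auto simp: chains_def)
qed

lemma bd_bd:
  assumes c: "c \<in> chains n (Suc q)"
  shows "bd n q (bd n (Suc q) c) \<tau> = 0"
proof (cases "finite \<tau>")
  case False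
  \<comment> \<open>\<open>ssgn_insert\<close> needs a finite set, so infinite \<tau> are treated
    apart: adding a vertex does not turn them into faces.\<close>
  then have "bd n (Suc q) c (insert v \<tau>) = 0" for v
    using bd_in_chains[OF c] face_finite[of n q "insert v \<tau>"] by (auto simp: chains_def)
  then show ?thesis
    by (simp add: bd_coeff[OF bd_in_chains[OF c]])
next
  case True
  let ?V = "{A. vert n A} - \<tau>"
  \<comment> \<open>The summand for adding \<open>v\<close> and then \<open>w\<close>. Exchanging
    the two only negates \<open>esgn v w\<close>; the diagonal is set to 0 so that both sums can run
    over the same set.\<close>
  define T where "T v w = (if v = w then 0 else
    c (insert w (insert v \<tau>)) * ssgn \<tau> w * ssgn \<tau> v * esgn v w)" for v w
  have "bd n q (bd n (Suc q) c) \<tau>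
     = (\<Sum>v\<in>?V. \<Sum>w\<in>{A. vert n A} - insert v \<tau>. c (insert w (insert v \<tau>)) * ssgn (insert v \<tau>) w * ssgn \<tau> v)"
    by (simp add: bd_coeff[OF bd_in_chains[OF c]] bd_coeff[OF c] sum_distrib_right)
  also have "\<dots> = (\<Sum>v\<in>?V. \<Sum>w\<in>?V. T v w)"
    using True finite_verts[of n]
    by (intro sum.cong refl sum.mono_neutral_cong_left) (auto simp: T_def ssgn_insert)
  finally have 1: "bd n q (bd n (Suc q) c) \<tau> = (\<Sum>v\<in>?V. \<Sum>w\<in>?V. T v w)" .
  also have "\<dots> = (\<Sum>w\<in>?V. \<Sum>v\<in>?V. T v w)"
    by (rule sum.swap)
  also have "\<dots> = (\<Sum>w\<in>?V. \<Sum>v\<in>?V. - T w v)"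
  proof (intro sum.cong refl)
    fix v w assume "v \<in> ?V" "w \<in> ?V"
    then have "finite v" "finite w"
      using vert_finite by auto
    then show "T v w = - T w v"
      using esgn_swap[of v w] by (cases "v = w") (simp_all add: T_def insert_commute[of v w])
  qed
  also have "\<dots> = - bd n q (bd n (Suc q) c) \<tau>"
    unfolding 1 by (simp add: sum_negf)
  finally show ?thesis by simp
qed

text \<open>At the empty face \<open>bd n 0\<close> is the augmentation and elsewhere it is 0, so
  the separate clause for degree 0 already says that the boundary vanishes.\<close>

lemma cycles_eq: "cycles n q = {c \<in> chains n q. \<forall>\<tau>. bd n q c \<tau> = 0}"
proof -
  have "(\<Sum>\<sigma>\<in>faces n 0. c \<sigma>) = 0 \<longleftrightarrow> (\<forall>\<tau>. bd n 0 c \<tau> = 0)" for c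
  proof -
    have "inc \<sigma> \<tau> = (if \<tau> = {} then 1 else 0)" if "\<sigma> \<in> faces n 0" for \<sigma> \<tau>
    proof -
      obtain v where "\<sigma> = {v}"
        using \<open>\<sigma> \<in> faces n 0\<close> by (auto simp: faces_def face_def card_1_singleton_iff)
      moreover have "finite v"
        using that face_blocks_finite calculation by (auto simp: faces_def)
      ultimately show ?thesis
        by (simp add: inc_eq ssgn_def)
    qed
    then have "bd n 0 c \<tau> = (if \<tau> = {} then (\<Sum>\<sigma>\<in>faces n 0. c \<sigma>) else 0)" for \<tau>
      unfolding bd_def by (auto intro: sum.cong)
    then show ?thesis by simp
  qed
  then show ?thesis
    by (auto simp: cycles_def fun_eq_iff)
qed

lemma bdries_cycles: "b \<in> bdries n q \<Longrightarrow> b \<in> cycles n q"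
  by (auto simp: bdries_def cycles_eq bd_in_chains bd_bd)

lemma cycles_add: "c \<in> cycles n q \<Longrightarrow> d \<in> cycles n q \<Longrightarrow> (\<lambda>\<tau>. c \<tau> + d \<tau>) \<in> cycles n q"
  by (simp add: cycles_eq chains_add bd_add)

lemma cycles_diff: "c \<in> cycles n q \<Longrightarrow> d \<in> cycles n q \<Longrightarrow> (\<lambda>\<tau>. c \<tau> - d \<tau>) \<in> cycles n q"
  by (simp add: cycles_eq chains_diff bd_diff)

lemma bdries_add: "c \<in> bdries n q \<Longrightarrow> d \<in> bdries n q \<Longrightarrow> (\<lambda>\<tau>. c \<tau> + d \<tau>) \<in> bdries n q"
proof -
  assume "c \<in> bdries n q" "d \<in> bdries n q"
  then obtain x y where xy: "x \<in> chains n (Suc q)" "c = bd n (Suc q) x"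
      "y \<in> chains n (Suc q)" "d = bd n (Suc q) y"
    by (auto simp: bdries_def)
  then have "(\<lambda>\<tau>. c \<tau> + d \<tau>) = bd n (Suc q) (\<lambda>\<tau>. x \<tau> + y \<tau>)"
    by (auto simp: bd_add)
  then show ?thesis
    using xy chains_add by (auto simp: bdries_def)
qed

lemma zero_bdries: "(\<lambda>_. 0) \<in> bdries n q"
  unfolding bdries_def by (rule image_eqI[of _ _ "\<lambda>_. 0"]) (auto simp: chains_def bd_def)

lemma cycles_sum:
  assumes "\<And>x. x \<in> X \<Longrightarrow> c x \<in> cycles n q"
  shows "(\<lambda>\<tau>. \<Sum>x\<in>X. k x * c x \<tau>) \<in> cycles n q"
  unfolding cycles_eq chains_def
proof (intro CollectI conjI allI impI)
  fix \<tau> assume "(\<Sum>x\<in>X. k x * c x \<tau>) \<noteq> 0"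
  then obtain x where "x \<in> X" "c x \<tau> \<noteq> 0"
    using sum.not_neutral_contains_not_neutral[of "\<lambda>x. k x * c x \<tau>" X] by auto
  then show "face n q \<tau>"
    using assms by (auto simp: cycles_eq chains_def)
next
  show "bd n q (\<lambda>\<tau>. \<Sum>x\<in>X. k x * c x \<tau>) \<tau> = 0" for \<tau>
    using assms by (simp add: bd_sum cycles_eq)
qed

section \<open>Filtration by the number of non-singleton blocks\<close>

definition big :: "nat \<Rightarrow> nat \<Rightarrow> nat set set \<Rightarrow> bool" where
  "big n q \<sigma> \<longleftrightarrow> face n q \<sigma> \<and> \<Union>\<sigma> = {1..n} \<and> (\<forall>A\<in>\<sigma>. card A \<noteq> 1)"

lemma bdries_facet:
  assumes b: "b \<in> bdries n q" and \<sigma>: "\<Union>\<sigma> = {1..n}"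
  shows "b \<sigma> = 0"
proof -
  obtain d where d: "d \<in> chains n (Suc q)" "b = bd n (Suc q) d"
    using b by (auto simp: bdries_def)
  have "d (insert v \<sigma>) = 0" if "vert n v" "v \<notin> \<sigma>" for v
  proof -
    obtain x where x: "x \<in> v" "x \<in> {1..n}"
      using \<open>vert n v\<close> unfolding vert_def by blast
    then obtain A where "A \<in> \<sigma>" "x \<in> A"
      using \<sigma> by blast
    then have "\<not> face n (Suc q) (insert v \<sigma>)"
      using x that by (auto simp: face_def pairwise_insert disjnt_def)
    then show ?thesis
      using d by (auto simp: chains_def)
  qed
  then show ?thesis
    by (auto simp: d bd_coeff[OF d(1)] intro!: sum.neutral)
qed

definition nonsing :: "nat set set \<Rightarrow> nat" where
  "nonsing \<tau> = card {A\<in>\<tau>. card A \<noteq> 1}"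

text \<open>Points covered by singletons are kept, so the set is the same for all faces with the
  same non-singleton blocks. Hence these faces share one cone point.\<close>

definition resid :: "nat \<Rightarrow> nat set set \<Rightarrow> nat set" where
  "resid n \<tau> = {1..n} - \<Union>{A\<in>\<tau>. card A \<noteq> 1}"

text \<open>The faces with a prescribed set of non-singleton blocks form a simplex on the singletons
  in the residual set; it is coned off from the least residual point.\<close>

definition cone :: "nat \<Rightarrow> (nat set set \<Rightarrow> int) \<Rightarrow> nat set set \<Rightarrow> int" where
  "cone n c \<tau> = (let m = {Min (resid n \<tau>)} in
     if resid n \<tau> \<noteq> {} \<and> m \<in> \<tau> then ssgn \<tau> m * c (\<tau> - {m}) else 0)"

lemma nonsing_insert:
  assumes "finite \<tau>" "v \<notin> \<tau>"
  shows "nonsing (insert v \<tau>) = (if card v = 1 then nonsing \<tau> else Suc (nonsing \<tau>))"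
proof -
  have "{A \<in> insert v \<tau>. card A \<noteq> 1} =
      (if card v = 1 then {A\<in>\<tau>. card A \<noteq> 1} else insert v {A\<in>\<tau>. card A \<noteq> 1})"
    by auto
  then show ?thesis using assms by (simp add: nonsing_def)
qed

lemma resid_insert: "card v = 1 \<Longrightarrow> resid n (insert v \<tau>) = resid n \<tau>"
  unfolding resid_def by (rule arg_cong[where f = "\<lambda>X. {1..n} - \<Union>X"]) auto

lemma nonsing_remove: "nonsing (\<tau> - {{m}}) = nonsing \<tau>"
  unfolding nonsing_def by (rule arg_cong[where f = card]) auto

lemma cone_nonzeroD:
  assumes "cone n c \<tau> \<noteq> 0"
  obtains m where "m = Min (resid n \<tau>)" "m \<in> resid n \<tau>" "{m} \<in> \<tau>" "c (\<tau> - {{m}}) \<noteq> 0"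
proof -
  have "finite (resid n \<tau>)" by (simp add: resid_def)
  with assms show ?thesis
    by (intro that[of "Min (resid n \<tau>)"]) (auto simp: cone_def Let_def split: if_splits)
qed

lemma vert_singleton: "n \<ge> 2 \<Longrightarrow> x \<in> {1..n} \<Longrightarrow> vert n {x}"
  unfolding vert_def by (metis One_nat_def Suc_1 card.empty card_atLeastAtMost card_insert_disjoint
      diff_Suc_1 empty_not_insert empty_subsetI equals0D finite.emptyI insert_subset not_less_eq_eq order_refl)

lemma cone_in_chains:
  assumes n: "n \<ge> 2" and c: "c \<in> chains n q"
  shows "cone n c \<in> chains n (Suc q)"
  unfolding chains_def
proof (intro CollectI allI impI)
  fix \<tau> assume "cone n c \<tau> \<noteq> 0"
  then obtain m where m: "m \<in> resid n \<tau>" "{m} \<in> \<tau>" "c (\<tau> - {{m}}) \<noteq> 0"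
    by (rule cone_nonzeroD)
  let ?\<rho> = "\<tau> - {{m}}"
  have f: "face n q ?\<rho>"
    using c m by (auto simp: chains_def)
  have \<tau>: "\<tau> = insert {m} ?\<rho>"
    using m by blast
  have "vert n {m}"
    using m n by (simp add: vert_singleton resid_def)
  moreover have "disjnt {m} A" if A: "A \<in> ?\<rho>" for A
  proof (cases "card A = 1")
    case True
    then show ?thesis
      using A by (auto simp: card_1_singleton_iff)
  next
    case False
    then show ?thesis
      using A m by (auto simp: resid_def)
  qed
  ultimately show "face n (Suc q) \<tau>"
    by (subst \<tau>) (rule face_insertI[OF f])
qed

text \<open>A singleton block would lie inside a non-singleton one, against disjointness.\<close>

lemma resid_empty_big:
  assumes f: "face n q \<tau>" and "resid n \<tau> = {}"
  shows "big n q \<tau>"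
proof -
  have cov: "{1..n} \<subseteq> \<Union>{A\<in>\<tau>. card A \<noteq> 1}"
    using assms by (simp add: resid_def)
  have sub: "\<Union>\<tau> \<subseteq> {1..n}"
    using f by (auto simp: face_def vert_def)
  have "card A \<noteq> 1" if A\<tau>: "A \<in> \<tau>" for A
  proof
    assume "card A = 1"
    then obtain x where A: "A = {x}" by (auto simp: card_1_singleton_iff)
    then obtain B where "B \<in> \<tau>" "card B \<noteq> 1" "x \<in> B"
      using cov sub A\<tau> by blast
    then show False
      using f A A\<tau> \<open>card A = 1\<close> unfolding face_def pairwise_def disjnt_def
      by (metis disjoint_iff singletonI)
  qed
  then show ?thesis
    using f cov sub by (auto simp: big_def)
qed

text \<open>On a simplex with a cone point, coning is a contracting homotopy, so it lifts cycles.
  Here the same computation holds at level \<open>k\<close> and above, because adding a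
  non-singleton block there leaves the support of \<open>c\<close>. Below level \<open>k\<close>
  nothing is claimed.\<close>

lemma bd_cone:
  assumes n: "n \<ge> 2" and c: "c \<in> cycles n q" and b: "\<And>\<sigma>. big n q \<sigma> \<Longrightarrow> c \<sigma> = 0"
    and k: "\<And>\<sigma>. c \<sigma> \<noteq> 0 \<Longrightarrow> nonsing \<sigma> \<le> k" and \<tau>: "k \<le> nonsing \<tau>"
  shows "bd n (Suc q) (cone n c) \<tau> = c \<tau>"
proof (cases "face n q \<tau>")
  case False
  have cc: "c \<in> chains n q" using c by (simp add: cycles_eq)
  from False cc bd_in_chains[OF cone_in_chains[OF n cc]] show ?thesis
    unfolding chains_def by force
next
  case f: True
  define m where "m = {Min (resid n \<tau>)}"
  let ?V = "{A. vert n A}" and ?d = "cone n c"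
  note fin = face_finite[OF f]
  have cc: "c \<in> chains n q" using c by (simp add: cycles_eq)
  have bd: "bd n (Suc q) ?d \<tau> = (\<Sum>v\<in>?V - \<tau>. ?d (insert v \<tau>) * ssgn \<tau> v)"
    by (rule bd_coeff[OF cone_in_chains[OF n cc]])
  have dk: "nonsing \<sigma> \<le> k" if "?d \<sigma> \<noteq> 0" for \<sigma>
    using that k nonsing_remove by (metis cone_nonzeroD)
  \<comment> \<open>Adding a non-singleton block lifts \<tau> above level \<open>k\<close>, where
    the cone vanishes; only singletons contribute to its boundary.\<close>
  have d0: "?d (insert v \<tau>) = 0" if "v \<notin> \<tau>" "card v \<noteq> 1" for v
    using dk[of "insert v \<tau>"] nonsing_insert[OF fin that(1)] that \<tau> by fastforce
  show ?thesis
  proof (cases "resid n \<tau> = {}")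
    case True
    then have "?d (insert v \<tau>) = 0" if "v \<notin> \<tau>" for v
      using d0[OF that] resid_insert[of v n \<tau>] by (cases "card v = 1") (auto simp: cone_def)
    then have "bd n (Suc q) ?d \<tau> = 0"
      unfolding bd by (intro sum.neutral) auto
    then show ?thesis
      using b resid_empty_big[OF f True] by simp
  next
    case ne: False
    then have min: "Min (resid n \<tau>) \<in> resid n \<tau>"
      using Min_in[of "resid n \<tau>"] by (simp add: resid_def)
    have mV: "m \<in> ?V"
      using min n vert_singleton[of n "Min (resid n \<tau>)"] by (simp add: resid_def m_def)
    have d1: "?d (insert v \<tau>) = (if m \<in> insert v \<tau> then ssgn (insert v \<tau>) m * c (insert v \<tau> - {m}) else 0)"
      if "card v = 1" for v
      using ne resid_insert[OF that, of n \<tau>] by (simp add: cone_def Let_def m_def)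
    show ?thesis
    proof (cases "m \<in> \<tau>")
      case False
      \<comment> \<open>If \<tau> misses the cone point, a face containing it is reached only by
        adding it, and the two copies of \<open>ssgn \<tau> m\<close> cancel.\<close>
      have "?d (insert v \<tau>) * ssgn \<tau> v = (if v = m then c \<tau> else 0)" if "v \<in> ?V - \<tau>" for v
      proof (cases "card v = 1")
        case True
        then show ?thesis
          using False d1[OF True] that by (auto simp: ssgn_insert_self mult.commute mult.left_commute)
      next
        case False
        then show ?thesis using d0 that by (auto simp: m_def)
      qed
      then have "bd n (Suc q) ?d \<tau> = (\<Sum>v\<in>?V - \<tau>. if v = m then c \<tau> else 0)"
        unfolding bd by (intro sum.cong) auto
      also have "\<dots> = c \<tau>"
        using mV False finite_verts[of n] by (simp add: sum.delta)
      finally show ?thesis .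
    next
      case True
      define \<rho> where "\<rho> = \<tau> - {m}"
      have \<rho>: "\<tau> = insert m \<rho>" "m \<notin> \<rho>" "finite \<rho>"
        using True fin by (auto simp: \<rho>_def)
      have "?d (insert v \<tau>) * ssgn \<tau> v = - ssgn \<rho> m * (c (insert v \<rho>) * ssgn \<rho> v)"
        if v: "v \<in> ?V - \<tau>" for v
      proof (cases "card v = 1")
        case c1: True
        have "insert v \<tau> - {m} = insert v \<rho>"
          using v True by (auto simp: \<rho>_def)
        then have e1: "?d (insert v \<tau>) = ssgn (insert v \<tau>) m * c (insert v \<rho>)"
          using d1[OF c1] True by simp
        have e2: "ssgn (insert v \<tau>) m = esgn v m * ssgn \<rho> m"
          using v ssgn_insert[OF fin, of v m] ssgn_insert_self[of m \<rho>] \<rho>(1) by simp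
        have e3: "ssgn \<tau> v = esgn m v * ssgn \<rho> v"
          unfolding \<rho>(1) by (rule ssgn_insert[OF \<rho>(3,2)])
        have "v \<noteq> m" using v True by auto
        then have e4: "esgn v m = - esgn m v"
          using v mV vert_finite by (intro esgn_swap) auto
        have "?d (insert v \<tau>) * ssgn \<tau> v
            = - (esgn m v * esgn m v) * (ssgn \<rho> m * (c (insert v \<rho>) * ssgn \<rho> v))"
          unfolding e1 e2 e3 e4 by algebra
        then show ?thesis by (simp only: esgn_square mult_minus_left mult_1)
      next
        case c1: False
        have "nonsing (insert v \<rho>) = Suc (nonsing \<tau>)"
          using v c1 nonsing_insert[OF \<rho>(3), of v] nonsing_remove[of \<tau> "Min (resid n \<tau>)"]
          unfolding \<rho>_def m_def by simp
        then have "c (insert v \<rho>) = 0"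
          using k[of "insert v \<rho>"] \<tau> by fastforce
        then show ?thesis using d0 v c1 by simp
      qed
      then have "bd n (Suc q) ?d \<tau> = - ssgn \<rho> m * (\<Sum>v\<in>?V - \<tau>. c (insert v \<rho>) * ssgn \<rho> v)"
        unfolding bd sum_distrib_left by (intro sum.cong) auto
      \<comment> \<open>The cycle condition is used at \<tau> without its cone point: the summand
        \<open>v = m\<close> is \<open>c \<tau>\<close> up to sign, and the others are, up to a
        common sign, those of the boundary of the cone.\<close>
      moreover have "0 = (\<Sum>v\<in>?V - \<rho>. c (insert v \<rho>) * ssgn \<rho> v)"
        using c bd_coeff[OF cc, of \<rho>] by (simp add: cycles_eq)
      moreover have "\<dots> = c \<tau> * ssgn \<rho> m + (\<Sum>v\<in>?V - \<tau>. c (insert v \<rho>) * ssgn \<rho> v)"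
      proof -
        have "?V - \<rho> = insert m (?V - \<tau>)" "m \<notin> ?V - \<tau>"
          using mV \<rho> by auto
        moreover have "insert m \<rho> = \<tau>" "finite (?V - \<tau>)"
          using \<rho>(1) finite_verts by auto
        ultimately show ?thesis by (simp only: sum.insert not_False_eq_True)
      qed
      ultimately have "bd n (Suc q) ?d \<tau> = c \<tau> * (ssgn \<rho> m * ssgn \<rho> m)"
        by algebra
      then show ?thesis by simp
    qed
  qed
qed

text \<open>Subtracting the boundary of the cone clears the top level \<open>k\<close>. It keeps the
  zeros on the big facets, because boundaries vanish there.\<close>

lemma cycle_bdry_filtered:
  assumes n: "n \<ge> 2"
  shows "c \<in> cycles n q \<Longrightarrow> (\<And>\<sigma>. big n q \<sigma> \<Longrightarrow> c \<sigma> = 0) \<Longrightarrow>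
    (\<And>\<sigma>. c \<sigma> \<noteq> 0 \<Longrightarrow> nonsing \<sigma> < k) \<Longrightarrow> c \<in> bdries n q"
proof (induction k arbitrary: c)
  case 0
  then have "c = (\<lambda>_. 0)" by (intro ext) blast
  then show ?case using zero_bdries by simp
next
  case (Suc k)
  let ?b = "bd n (Suc q) (cone n c)"
  have b: "?b \<in> bdries n q"
    using cone_in_chains[OF n] Suc.prems(1) by (auto simp: bdries_def cycles_eq)
  let ?c = "\<lambda>\<tau>. c \<tau> - ?b \<tau>"
  have bc: "?b \<tau> = c \<tau>" if "k \<le> nonsing \<tau>" for \<tau>
    by (rule bd_cone[OF n Suc.prems(1,2)]) (use Suc.prems(3) that less_Suc_eq_le in blast)+
  have "?c \<in> bdries n q"
  proof (rule Suc.IH)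
    show "?c \<in> cycles n q"
      by (rule cycles_diff[OF Suc.prems(1) bdries_cycles[OF b]])
    show "?c \<sigma> = 0" if "big n q \<sigma>" for \<sigma>
      using Suc.prems(2)[OF that] bdries_facet[OF b] that by (simp add: big_def)
    show "nonsing \<sigma> < k" if "?c \<sigma> \<noteq> 0" for \<sigma>
      using bc[of \<sigma>] that by (cases "k \<le> nonsing \<sigma>") auto
  qed
  from bdries_add[OF this b] show ?case by simp
qed

lemma cycle_bdry_iff:
  assumes n: "n \<ge> 2" and c: "c \<in> cycles n q"
  shows "c \<in> bdries n q \<longleftrightarrow> (\<forall>\<sigma>. big n q \<sigma> \<longrightarrow> c \<sigma> = 0)"
proof
  assume "c \<in> bdries n q"
  then show "\<forall>\<sigma>. big n q \<sigma> \<longrightarrow> c \<sigma> = 0"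
    using bdries_facet by (auto simp: big_def)
next
  assume "\<forall>\<sigma>. big n q \<sigma> \<longrightarrow> c \<sigma> = 0"
  \<comment> \<open>A face in degree \<open>q\<close> has \<open>q + 1\<close> blocks, so its level
    is at most \<open>q + 1\<close>; the bound is strict.\<close>
  moreover have "nonsing \<sigma> < Suc (Suc q)" if "c \<sigma> \<noteq> 0" for \<sigma>
  proof -
    have f: "face n q \<sigma>"
      using c that by (auto simp: cycles_eq chains_def)
    then have "nonsing \<sigma> \<le> card \<sigma>"
      unfolding nonsing_def using face_finite by (intro card_mono) auto
    then show ?thesis
      using f by (simp add: face_def)
  qed
  ultimately show "c \<in> bdries n q"
    using cycle_bdry_filtered[OF n c] by blast
qed

section \<open>The join cycles of the big facets\<close>

text \<open>Stated for unsorted lists, because replacing a block by a singleton can move it in the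
  vertex order, while the terms of a join cycle have to be compared position by position.\<close>

lemma bd_ochain:
  assumes f: "face n q (set ys)" and ys: "distinct ys"
  shows "bd n q (ochain ys) \<tau> = (\<Sum>i<length ys. (-1) ^ i *
    (if \<tau> = set (take i ys @ drop (Suc i) ys) then isgn (take i ys @ drop (Suc i) ys) else 0))"
proof -
  note fin = face_blocks_finite[OF f]
  have "bd n q (ochain ys) \<tau> = (\<Sum>\<sigma>\<in>faces n q. if \<sigma> = set ys then tsign ys * inc (set ys) \<tau> else 0)"
    unfolding bd_def ochain_def by (intro sum.cong) auto
  also have "\<dots> = tsign ys * inc (set ys) \<tau>"
    using f finite_faces[of n q] by (simp add: faces_def)
  also have "\<dots> = (\<Sum>v\<in>set ys. if \<tau> = set ys - {v} then isgn ys * ssgn (set ys) v else 0)"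
    using fin by (simp add: inc_eq tsign_eq_isgn[OF ys fin] sum_distrib_left if_distrib cong: if_cong)
  also have "\<dots> = (\<Sum>i<length ys. if \<tau> = set ys - {ys ! i} then isgn ys * ssgn (set ys) (ys ! i) else 0)"
    by (rule sum.reindex_bij_betw[OF bij_betw_nth[OF ys], symmetric]) auto
  also have "\<dots> = (\<Sum>i<length ys. (-1) ^ i *
    (if \<tau> = set (take i ys @ drop (Suc i) ys) then isgn (take i ys @ drop (Suc i) ys) else 0))"
  proof (intro sum.cong refl)
    fix i assume "i \<in> {..<length ys}"
    then have i: "i < length ys" by simp
    let ?p = "take i ys" and ?z = "drop (Suc i) ys"
    have split: "ys = ?p @ ys ! i # ?z"
      using id_take_nth_drop[OF i] .
    have d: "distinct (?p @ ys ! i # ?z)" "\<forall>A\<in>set (?p @ ys ! i # ?z). finite A"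
      using ys fin split by metis+
    then have "set ys - {ys ! i} = set (?p @ ?z)"
      by (subst split) auto
    moreover have "isgn ys * ssgn (set ys) (ys ! i) = (-1) ^ i * isgn (?p @ ?z)"
      using isgn_delete[OF d] i by (simp flip: split)
    ultimately show "(if \<tau> = set ys - {ys ! i} then isgn ys * ssgn (set ys) (ys ! i) else 0) =
      (-1) ^ i * (if \<tau> = set (?p @ ?z) then isgn (?p @ ?z) else 0)"
      by simp
  qed
  finally show ?thesis .
qed

text \<open>Adding or removing \<open>i\<close> pairs the subsets with opposite signs and equal
  values of \<open>f\<close>.\<close>

lemma alternating_Pow_sum:
  assumes I: "finite I" "i \<in> I" and f: "\<And>S. f (insert i S) = f S"
  shows "(\<Sum>S\<in>Pow I. (-1) ^ card S * f S) = (0::int)"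
proof -
  let ?J = "I - {i}"
  have "Pow I = Pow ?J \<union> insert i ` Pow ?J"
    using Pow_insert[of i ?J] I by (simp add: insert_absorb)
  moreover have "Pow ?J \<inter> insert i ` Pow ?J = {}" "inj_on (insert i) (Pow ?J)"
    by (auto simp: inj_on_def)
  ultimately have "(\<Sum>S\<in>Pow I. (-1) ^ card S * f S) = (\<Sum>S\<in>Pow ?J. (-1) ^ card S * f S)
      + (\<Sum>S\<in>Pow ?J. (-1) ^ card (insert i S) * f (insert i S))"
    using I by (simp add: sum.union_disjoint sum.reindex)
  also have "(\<Sum>S\<in>Pow ?J. (-1) ^ card (insert i S) * f (insert i S)) = (\<Sum>S\<in>Pow ?J. - ((-1) ^ card S * f S))"
  proof (intro sum.cong refl)
    fix S assume "S \<in> Pow ?J"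
    then have "finite S" "i \<notin> S" using I finite_subset by auto
    then show "(-1) ^ card (insert i S) * f (insert i S) = - ((-1) ^ card S * f S)"
      by (simp add: f)
  qed
  finally show ?thesis by (simp add: sum_negf)
qed

definition zlist :: "nat set list \<Rightarrow> nat set \<Rightarrow> nat set list" where
  "zlist xs S = map (\<lambda>i. if i \<in> S then {Min (xs ! i)} else xs ! i) [0..<length xs]"

lemma zlist_face:
  assumes f: "face n q (set xs)" and d: "distinct xs"
  shows "face n q (set (zlist xs S))" and "distinct (zlist xs S)"
proof -
  define y where "y = (\<lambda>i. if i \<in> S then {Min (xs ! i)} else xs ! i)"
  have zl: "zlist xs S = map y [0..<length xs]"
    by (simp add: zlist_def y_def)
  have v: "vert n (xs ! i)" if "i < length xs" for i
    using f that by (simp add: face_def)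
  have dj: "disjnt (xs ! i) (xs ! j)" if "i < length xs" "j < length xs" "i \<noteq> j" for i j
    using f d that by (auto simp: face_def pairwise_def nth_eq_iff_index_eq)
  have sub: "y i \<subseteq> xs ! i" "y i \<noteq> {}" if "i < length xs" for i
    using v[OF that] vert_finite[OF v[OF that]] by (auto simp: vert_def y_def)
  have vy: "vert n (y i)" if "i < length xs" for i
    using v[OF that] sub[OF that] unfolding vert_def by blast
  have dy: "disjnt (y i) (y j)" if "i < length xs" "j < length xs" "i \<noteq> j" for i j
    using dj[OF that] sub[OF that(1)] sub[OF that(2)] unfolding disjnt_def by blast
  have "y i \<noteq> y j" if "i < length xs" "j < length xs" "i \<noteq> j" for i j
    using dy[OF that] sub(2)[OF that(1)] unfolding disjnt_def by auto
  then show dz: "distinct (zlist xs S)"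
    unfolding zl distinct_map inj_on_def
    by (metis atLeastLessThan_iff atLeastLessThan_upt distinct_upt)
  have set: "set (zlist xs S) = y ` {..<length xs}"
    by (auto simp: zl)
  have "card (set (zlist xs S)) = card (set xs)"
    unfolding distinct_card[OF dz] distinct_card[OF d] by (simp add: zl)
  moreover have "\<forall>A\<in>set (zlist xs S). vert n A"
    using vy unfolding set by blast
  moreover have "pairwise disjnt (set (zlist xs S))"
    unfolding set by (rule pairwise_imageI) (use dy in auto)
  ultimately show "face n q (set (zlist xs S))"
    using f by (simp only: face_def)
qed

text \<open>Deleting the \<open>i\<close>-th entry forgets whether \<open>i\<close> lies in
  \<open>S\<close>, so the terms for \<open>S\<close> with and without \<open>i\<close>
  cancel.\<close>

lemma zeta_cycle:
  assumes f: "face n q (set xs)" and d: "distinct xs"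
  shows "zeta xs \<in> cycles n q"
  unfolding cycles_eq chains_def
proof (intro CollectI conjI allI impI)
  have z: "zeta xs = (\<lambda>\<tau>. \<Sum>S\<in>Pow {..<length xs}. (-1) ^ card S * ochain (zlist xs S) \<tau>)"
    by (simp add: zeta_def zlist_def)
  fix \<tau>
  {
    assume "zeta xs \<tau> \<noteq> 0"
    then obtain S where "ochain (zlist xs S) \<tau> \<noteq> 0"
      unfolding z by (metis (no_types, lifting) mult_zero_right sum.neutral)
    then have "\<tau> = set (zlist xs S)"
      by (auto simp: ochain_def split: if_splits)
    then show "face n q \<tau>"
      using zlist_face(1)[OF f d] by simp
  }
  define D where "D i S = take i (zlist xs S) @ drop (Suc i) (zlist xs S)" for i S
  define F where "F i S = (if \<tau> = set (D i S) then isgn (D i S) else 0)" for i S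
  have D: "D i (insert i S) = D i S" if "i < length xs" for i S
    using that by (simp add: D_def zlist_def take_map drop_map take_upt drop_upt)
  have len: "length (zlist xs S) = length xs" for S
    by (simp add: zlist_def)
  have "bd n q (zeta xs) \<tau> = (\<Sum>S\<in>Pow {..<length xs}. (-1) ^ card S * bd n q (ochain (zlist xs S)) \<tau>)"
    unfolding z by (rule bd_sum)
  also have "\<dots> = (\<Sum>S\<in>Pow {..<length xs}. \<Sum>i<length xs. (-1) ^ i * ((-1) ^ card S * F i S))"
    unfolding bd_ochain[OF zlist_face[OF f d]] len F_def D_def sum_distrib_left
    by (intro sum.cong refl) (simp add: mult.left_commute)
  also have "\<dots> = (\<Sum>i<length xs. (-1) ^ i * (\<Sum>S\<in>Pow {..<length xs}. (-1) ^ card S * F i S))"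
    unfolding sum_distrib_left by (rule sum.swap)
  also have "\<dots> = 0"
    using D by (intro sum.neutral ballI) (simp add: alternating_Pow_sum F_def)
  finally show "bd n q (zeta xs) \<tau> = 0" .
qed

text \<open>Every nonempty \<open>S\<close> brings in a singleton block, so only
  \<open>S = {}\<close> is seen here. The join cycles of the big facets thus have the identity as
  their coefficient matrix on the big facets.\<close>

lemma zeta_big:
  assumes \<sigma>: "face n q \<sigma>" and \<tau>: "\<forall>A\<in>\<tau>. card A \<noteq> 1"
  shows "zeta (olist \<sigma>) \<tau> = (if \<tau> = \<sigma> then 1 else 0)"
proof -
  note fin = face_finite[OF \<sigma>] face_blocks_finite[OF \<sigma>]
  let ?xs = "olist \<sigma>"
  have "ochain (zlist ?xs S) \<tau> = 0" if S: "S \<in> Pow {..<length ?xs} - {{}}" for S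
  proof -
    obtain i where "i \<in> S" "i < length ?xs"
      using S by blast
    then have "{Min (?xs ! i)} \<in> set (zlist ?xs S)"
      by (force simp: zlist_def)
    then show ?thesis
      using \<tau> by (auto simp: ochain_def)
  qed
  then have "zeta ?xs \<tau> = (\<Sum>S\<in>{{}}. (-1) ^ card S * ochain (zlist ?xs S) \<tau>)"
    unfolding zeta_def zlist_def[symmetric] by (intro sum.mono_neutral_right) auto
  also have "\<dots> = ochain ?xs \<tau>"
    by (simp add: zlist_def map_nth)
  also have "\<dots> = (if \<tau> = \<sigma> then 1 else 0)"
    using fin by (simp add: ochain_def set_olist tsign_sorted sorted_olist)
  finally show ?thesis .
qed

lemma cycle_prescribed:
  fixes k :: "nat set set \<Rightarrow> int"
  assumes "finite X" "\<And>\<sigma>. \<sigma> \<in> X \<Longrightarrow> big n q \<sigma>"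
  defines "c \<equiv> \<lambda>\<tau>. \<Sum>\<sigma>\<in>X. k \<sigma> * zeta (olist \<sigma>) \<tau>"
  shows "c \<in> cycles n q" and "big n q \<tau> \<Longrightarrow> c \<tau> = (if \<tau> \<in> X then k \<tau> else 0)"
proof -
  have "zeta (olist \<sigma>) \<in> cycles n q" if "\<sigma> \<in> X" for \<sigma>
  proof -
    have f: "face n q \<sigma>" using assms that by (simp add: big_def)
    then show ?thesis
      using zeta_cycle[of n q "olist \<sigma>"] face_finite[OF f] face_blocks_finite[OF f]
      by (simp add: set_olist distinct_olist)
  qed
  then show "c \<in> cycles n q"
    unfolding c_def by (rule cycles_sum)
  assume \<tau>: "big n q \<tau>"
  have "c \<tau> = (\<Sum>\<sigma>\<in>X. if \<tau> = \<sigma> then k \<sigma> else 0)"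
    unfolding c_def using assms(2) \<tau>
    by (intro sum.cong refl) (simp add: zeta_big[of n q] big_def)
  then show "c \<tau> = (if \<tau> \<in> X then k \<tau> else 0)"
    using assms(1) by (simp add: sum.delta)
qed

section \<open>The action of the symmetric group\<close>

abbreviation fimage :: "(nat \<Rightarrow> nat) \<Rightarrow> nat set set \<Rightarrow> nat set set" where
  "fimage g \<sigma> \<equiv> (`) g ` \<sigma>"

text \<open>For a face \<sigma>, the coefficient of the oriented face
  \<open>fimage g \<sigma>\<close> in the \<open>g\<close>-image of the oriented face
  \<sigma>.\<close>

definition eps :: "(nat \<Rightarrow> nat) \<Rightarrow> nat set set \<Rightarrow> int" where
  "eps g \<sigma> = tsign (map ((`) g) (olist \<sigma>))"

lemma inj_image_blocks: "inj g \<Longrightarrow> inj ((`) g)"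
  by (simp add: inj_def inj_image_eq_iff)

lemma inj_on_blocks: "inj g \<Longrightarrow> inj_on ((`) g) X"
  using inj_image_blocks inj_on_subset by blast

lemma fimage_comp: "fimage (g \<circ> h) \<sigma> = fimage g (fimage h \<sigma>)"
  by (simp add: image_image image_comp)

lemma eps_square [simp]: "eps g \<sigma> * eps g \<sigma> = 1"
  by (simp add: eps_def tsign_square)

text \<open>Sorting the blocks after \<open>h\<close> and again after \<open>g\<close> amounts to
  sorting once at the end.\<close>

lemma eps_comp:
  assumes \<sigma>: "finite \<sigma>" "\<forall>A\<in>\<sigma>. finite A" and g: "inj g" and h: "inj h"
  shows "eps (g \<circ> h) \<sigma> = eps g (fimage h \<sigma>) * eps h \<sigma>"
proof -
  let ?ys = "map ((`) h) (olist \<sigma>)"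
  have "distinct ?ys"
    using distinct_olist[OF \<sigma>] inj_on_blocks[OF h] by (simp add: distinct_map)
  moreover have "\<forall>A\<in>set ?ys. finite A"
    using \<sigma> by (simp add: set_olist)
  moreover have "inj_on ((`) g) (set ?ys)"
    using inj_on_blocks[OF g] .
  ultimately have "tsign (map ((`) g) ?ys) = tsign ?ys * tsign (map ((`) g) (olist (set ?ys)))"
    by (intro tsign_map) auto
  moreover have "map ((`) g) ?ys = map ((`) (g \<circ> h)) (olist \<sigma>)" "set ?ys = fimage h \<sigma>"
    using \<sigma> by (auto simp: set_olist image_comp)
  ultimately show ?thesis
    by (simp only: eps_def mult.commute)
qed

text \<open>The sign of the \<open>g\<close>-image of \<open>v # olist \<sigma>\<close> is computed
  twice: by sorting the list before \<open>g\<close> is applied, and by counting inversions in the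
  image. It is the local form of the commutation of \<open>g\<close> with the boundary.\<close>

lemma eps_insert:
  assumes \<sigma>: "finite \<sigma>" "\<forall>A\<in>\<sigma>. finite A" and v: "finite v" "v \<notin> \<sigma>" and g: "inj g"
  shows "eps g (insert v \<sigma>) * ssgn (fimage g \<sigma>) (g ` v) = eps g \<sigma> * ssgn \<sigma> v"
proof -
  let ?L = "olist \<sigma>"
  have L: "set ?L = \<sigma>" "distinct ?L" "sorted_wrt vless ?L"
    using \<sigma> by (simp_all add: set_olist distinct_olist sorted_olist)
  have inj: "inj_on ((`) g) X" for X
    using inj_on_blocks[OF g] .
  have d: "distinct (v # ?L)" "\<forall>A\<in>set (v # ?L). finite A"
    using L \<sigma> v by auto
  have d': "distinct (map ((`) g) (v # ?L))" "\<forall>A\<in>set (map ((`) g) (v # ?L)). finite A"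
    using d inj unfolding distinct_map by auto
  have "tsign (map ((`) g) (v # ?L)) = tsign (v # ?L) * eps g (insert v \<sigma>)"
    using tsign_map[OF d inj] d(2) L by (simp add: eps_def)
  moreover have "tsign (v # ?L) = ssgn \<sigma> v"
    using L by (simp add: tsign_eq_isgn[OF d] isgn_sorted)
  moreover have "tsign (map ((`) g) (v # ?L)) = ssgn (fimage g \<sigma>) (g ` v) * eps g \<sigma>"
    using d' L unfolding tsign_eq_isgn[OF d'] eps_def by (simp add: tsign_eq_isgn)
  ultimately have "ssgn (fimage g \<sigma>) (g ` v) * eps g \<sigma> = ssgn \<sigma> v * eps g (insert v \<sigma>)"
    by simp
  moreover have "ssgn \<sigma> v * ssgn \<sigma> v = 1" "ssgn (fimage g \<sigma>) (g ` v) * ssgn (fimage g \<sigma>) (g ` v) = 1"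
    by simp_all
  ultimately show ?thesis by algebra
qed

lemma permutes_injective: "g permutes S \<Longrightarrow> inj g"
  using permutes_inj by blast

lemma vert_image: "g permutes {1..n} \<Longrightarrow> vert n (g ` A) \<longleftrightarrow> vert n A"
proof -
  assume g: "g permutes {1..n}"
  have "g ` A \<subseteq> g ` {1..n} \<longleftrightarrow> A \<subseteq> {1..n}" "g ` A = g ` {1..n} \<longleftrightarrow> A = {1..n}"
    using permutes_injective[OF g] by (simp_all only: inj_image_subset_iff inj_image_eq_iff)
  then show ?thesis
    unfolding vert_def permutes_image[OF g] by auto
qed

lemma face_image:
  assumes g: "g permutes {1..n}"
  shows "face n q (fimage g \<sigma>) \<longleftrightarrow> face n q \<sigma>"
proof -
  note inj = permutes_injective[OF g]
  have "card (fimage g \<sigma>) = card \<sigma>"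
    using inj_on_blocks[OF inj] by (simp add: card_image)
  moreover have "pairwise disjnt (fimage g \<sigma>) \<longleftrightarrow> pairwise disjnt \<sigma>"
    using inj by (simp add: pairwise_image pairwise_def disjnt_def inj_image_eq_iff image_Int[symmetric])
  ultimately show ?thesis
    using g by (simp add: face_def vert_image)
qed

lemma Union_fimage:
  assumes g: "g permutes {1..n}"
  shows "\<Union>(fimage g \<sigma>) = {1..n} \<longleftrightarrow> \<Union>\<sigma> = {1..n}"
proof -
  have "\<Union>(fimage g \<sigma>) = g ` \<Union>\<sigma>" by auto
  then have "\<Union>(fimage g \<sigma>) = {1..n} \<longleftrightarrow> g ` \<Union>\<sigma> = g ` {1..n}"
    using permutes_image[OF g] by simp
  then show ?thesis
    using permutes_injective[OF g] by (simp only: inj_image_eq_iff)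
qed

lemma big_image:
  assumes g: "g permutes {1..n}"
  shows "big n q (fimage g \<sigma>) \<longleftrightarrow> big n q \<sigma>"
proof -
  have "(\<forall>A\<in>fimage g \<sigma>. card A \<noteq> 1) \<longleftrightarrow> (\<forall>A\<in>\<sigma>. card A \<noteq> 1)"
    using permutes_injective[OF g] by (simp add: card_image inj_on_subset)
  then show ?thesis
    unfolding big_def face_image[OF g] Union_fimage[OF g] by simp
qed

text \<open>Evaluated at a translate, where a single face contributes to the defining sum. By
  \<open>fimage_inv\<close> every argument is a translate, so all values are covered.\<close>

lemma act_coeff:
  assumes c: "c \<in> chains n q" and g: "g permutes {1..n}"
  shows "act n q g c (fimage g \<sigma>) = c \<sigma> * eps g \<sigma>"
proof -
  have "act n q g c (fimage g \<sigma>) = (\<Sum>\<rho>\<in>faces n q. if \<rho> = \<sigma> then c \<sigma> * eps g \<sigma> else 0)"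
    unfolding act_def
  proof (intro sum.cong refl)
    fix \<rho> assume "\<rho> \<in> faces n q"
    then have "set (olist \<rho>) = \<rho>"
      using face_finite face_blocks_finite by (simp add: faces_def set_olist)
    moreover have "fimage g \<sigma> = fimage g \<rho> \<longleftrightarrow> \<rho> = \<sigma>"
      using inj_image_eq_iff[OF inj_image_blocks[OF permutes_injective[OF g]]] by auto
    ultimately show "c \<rho> * ochain (map ((`) g) (olist \<rho>)) (fimage g \<sigma>)
        = (if \<rho> = \<sigma> then c \<sigma> * eps g \<sigma> else 0)"
      by (simp add: ochain_def eps_def)
  qed
  also have "\<dots> = c \<sigma> * eps g \<sigma>"
    using c finite_faces[of n q] by (auto simp: chains_def faces_def)
  finally show ?thesis .
qed

lemma fimage_inv: "g permutes {1..n} \<Longrightarrow> fimage g (fimage (inv g) \<sigma>) = \<sigma>"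
  unfolding fimage_comp[symmetric] permutes_inv_o by simp

lemma act_chains:
  assumes c: "c \<in> chains n q" and g: "g permutes {1..n}"
  shows "act n q g c \<in> chains n q"
  unfolding chains_def
proof (intro CollectI allI impI)
  fix \<tau> assume "act n q g c \<tau> \<noteq> 0"
  then have "c (fimage (inv g) \<tau>) \<noteq> 0"
    using act_coeff[OF c g, of "fimage (inv g) \<tau>"] by (auto simp: fimage_inv[OF g])
  then have "face n q (fimage (inv g) \<tau>)"
    using c by (simp add: chains_def)
  then show "face n q \<tau>"
    using face_image[OF permutes_inv[OF g]] by simp
qed

lemma act_cycles:
  assumes c: "c \<in> cycles n q" and g: "g permutes {1..n}"
  shows "act n q g c \<in> cycles n q"
proof -
  have cc: "c \<in> chains n q" using c by (simp add: cycles_eq)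
  let ?V = "{A. vert n A}"
  note inj = inj_image_blocks[OF permutes_injective[OF g]]
  have "bd n q (act n q g c) (fimage g \<sigma>) = 0" for \<sigma>
  proof -
    \<comment> \<open>The vertices outside the translated face are the translates of those outside
      \<sigma>; this reindexes the boundary sum.\<close>
    have V: "?V - fimage g \<sigma> = (`) g ` (?V - \<sigma>)"
    proof -
      have "?V = (`) g ` ?V"
      proof
        show "?V \<subseteq> (`) g ` ?V"
        proof
          fix A assume "A \<in> ?V"
          moreover have "A = g ` (inv g ` A)"
            by (simp add: image_image permutes_inverses(1)[OF g])
          ultimately show "A \<in> (`) g ` ?V"
            using vert_image[OF permutes_inv[OF g]] by blast
        qed
      qed (use vert_image[OF g] in auto)
      then show ?thesis
        using image_set_diff[OF inj, of ?V \<sigma>] by simp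
    qed
    have "bd n q (act n q g c) (fimage g \<sigma>)
        = (\<Sum>v\<in>?V - \<sigma>. act n q g c (fimage g (insert v \<sigma>)) * ssgn (fimage g \<sigma>) (g ` v))"
      unfolding bd_coeff[OF act_chains[OF cc g]] V
      by (subst sum.reindex) (use inj inj_on_subset in \<open>auto\<close>)
    also have "\<dots> = (\<Sum>v\<in>?V - \<sigma>. eps g \<sigma> * (c (insert v \<sigma>) * ssgn \<sigma> v))"
    proof (intro sum.cong refl)
      fix v assume v: "v \<in> ?V - \<sigma>"
      show "act n q g c (fimage g (insert v \<sigma>)) * ssgn (fimage g \<sigma>) (g ` v)
          = eps g \<sigma> * (c (insert v \<sigma>) * ssgn \<sigma> v)"
      \<comment> \<open>\<open>eps_insert\<close> needs finite sets; these are available where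
        \<open>c\<close> is nonzero, since its support consists of faces.\<close>
      proof (cases "c (insert v \<sigma>) = 0")
        case False
        then have f: "face n q (insert v \<sigma>)"
          using cc by (simp add: chains_def)
        have "eps g (insert v \<sigma>) * ssgn (fimage g \<sigma>) (g ` v) = eps g \<sigma> * ssgn \<sigma> v"
          using v face_finite[OF f] face_blocks_finite[OF f] permutes_injective[OF g]
          by (intro eps_insert) auto
        then show ?thesis
          unfolding act_coeff[OF cc g] by (simp add: ac_simps)
      qed (simp only: act_coeff[OF cc g] mult_zero_left mult_zero_right)
    qed
    also have "\<dots> = eps g \<sigma> * bd n q c \<sigma>"
      unfolding bd_coeff[OF cc] sum_distrib_left ..
    finally show ?thesis
      using c by (simp add: cycles_eq)
  qed
  from this[of "fimage (inv g) _"] show ?thesis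
    by (simp add: cycles_eq act_chains[OF cc g] fimage_inv[OF g])
qed

section \<open>Shapes of facets\<close>

definition shape :: "nat set set \<Rightarrow> nat list" where
  "shape \<sigma> = map card (olist \<sigma>)"

lemma sorted_shape:
  assumes "finite \<sigma>" "\<forall>A\<in>\<sigma>. finite A"
  shows "sorted (rev (shape \<sigma>))"
proof -
  have "sorted_wrt (\<lambda>A B. card A \<ge> card B) (olist \<sigma>)"
    by (rule sorted_wrt_mono_rel[OF _ sorted_olist[OF assms]]) (auto simp: vless_def)
  then show ?thesis
    by (simp add: shape_def sorted_wrt_rev sorted_wrt_map)
qed

lemma mset_shape:
  assumes "finite \<sigma>" "\<forall>A\<in>\<sigma>. finite A"
  shows "mset (shape \<sigma>) = image_mset card (mset_set \<sigma>)"
  using mset_set_set[OF distinct_olist[OF assms]] assms by (simp add: shape_def set_olist)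

text \<open>A weakly decreasing list is determined by its multiset of entries, and \<open>g\<close>
  preserves block sizes.\<close>

lemma shape_image:
  assumes \<sigma>: "finite \<sigma>" "\<forall>A\<in>\<sigma>. finite A" and g: "inj g"
  shows "shape (fimage g \<sigma>) = shape \<sigma>"
proof -
  have \<sigma>': "finite (fimage g \<sigma>)" "\<forall>A\<in>fimage g \<sigma>. finite A"
    using \<sigma> by auto
  have "mset_set (fimage g \<sigma>) = image_mset ((`) g) (mset_set \<sigma>)"
    using inj_on_blocks[OF g] by (simp add: image_mset_mset_set)
  then have "mset (shape (fimage g \<sigma>)) = image_mset (\<lambda>A. card (g ` A)) (mset_set \<sigma>)"
    unfolding mset_shape[OF \<sigma>'] by (simp add: image_mset.compositionality comp_def)
  also have "\<dots> = mset (shape \<sigma>)"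
    using g unfolding mset_shape[OF \<sigma>] by (simp add: card_image inj_on_subset)
  finally have "mset (rev (shape (fimage g \<sigma>))) = mset (rev (shape \<sigma>))" by simp
  then have "rev (shape (fimage g \<sigma>)) = rev (shape \<sigma>)"
    using sorted_shape[OF \<sigma>] sorted_shape[OF \<sigma>'] by (metis properties_for_sort)
  then show ?thesis by simp
qed

lemma facets_shape_eq:
  assumes "lam \<in> Parts n q"
  shows "facets_shape n lam = {\<sigma>. big n q \<sigma> \<and> shape \<sigma> = lam}"
proof -
  have q: "length lam - 1 = q" and 1: "\<forall>p\<in>set lam. p \<noteq> 1"
    using assms by (auto simp: Parts_def)
  have "\<forall>A\<in>\<sigma>. card A \<noteq> 1" if "face n q \<sigma>" "shape \<sigma> = lam" for \<sigma>
    using 1 face_finite[OF that(1)] face_blocks_finite[OF that(1)]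
    unfolding that(2)[symmetric] by (simp add: shape_def set_olist)
  then show ?thesis
    unfolding facets_shape_def q big_def shape_def by blast
qed

lemma shape_Parts:
  assumes "big n q \<sigma>"
  shows "shape \<sigma> \<in> Parts n q"
proof -
  have f: "face n q \<sigma>" "\<Union>\<sigma> = {1..n}" "\<forall>A\<in>\<sigma>. card A \<noteq> 1"
    using assms by (auto simp: big_def)
  note fin = face_finite[OF f(1)] face_blocks_finite[OF f(1)]
  have "sum_list (shape \<sigma>) = sum card \<sigma>"
    using sum_list_distinct_conv_sum_set[OF distinct_olist[OF fin], of card] fin
    by (simp add: shape_def set_olist)
  also have "\<dots> = card (\<Union>\<sigma>)"
    using f fin by (intro card_Union_disjoint[symmetric]) (auto simp: face_def)
  finally have "sum_list (shape \<sigma>) = n"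
    using f by simp
  moreover have "card A > 0 \<and> card A \<noteq> n" if "A \<in> \<sigma>" for A
  proof -
    have "vert n A" using f that by (simp add: face_def)
    then have "A \<subset> {1..n}" "A \<noteq> {}" by (auto simp: vert_def)
    then show ?thesis
      using psubset_card_mono[of "{1..n}" A] fin that by (auto simp: card_gt_0_iff)
  qed
  moreover have "length (shape \<sigma>) = Suc q"
    using f fin by (simp add: shape_def length_olist face_def)
  moreover have "set (shape \<sigma>) = card ` \<sigma>"
    using fin by (simp add: shape_def set_olist)
  ultimately show ?thesis
    using f sorted_shape[OF fin] by (auto simp: Parts_def)
qed

section \<open>Minimal faces and Young subgroups\<close>

definition minface :: "nat list \<Rightarrow> nat set set" where
  "minface lam = blk lam ` {..<length lam}"

lemma sum_list_take_Suc:
  "i < length lam \<Longrightarrow> sum_list (take (Suc i) lam) = sum_list (take i lam) + (lam ! i :: nat)"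
  by (simp add: take_Suc_conv_app_nth)

lemma sum_list_take_mono:
  assumes "i \<le> j"
  shows "sum_list (take i lam) \<le> (sum_list (take j lam) :: nat)"
  using assms
proof (induction j rule: dec_induct)
  case (step j)
  then show ?case
    by (cases "j < length lam") (auto simp: sum_list_take_Suc)
qed simp

lemma card_blk: "i < length lam \<Longrightarrow> card (blk lam i) = lam ! i"
  by (simp add: blk_def sum_list_take_Suc)

lemma blk_disjnt_less: "i < j \<Longrightarrow> disjnt (blk lam i) (blk lam j)"
  using sum_list_take_mono[of "Suc i" j lam] by (force simp: blk_def disjnt_def)

lemma blk_disjnt: "i \<noteq> j \<Longrightarrow> disjnt (blk lam i) (blk lam j)"
  using blk_disjnt_less by (metis disjnt_sym linorder_neqE_nat)

lemma UN_blk: "k \<le> length lam \<Longrightarrow> (\<Union>i<k. blk lam i) = {1..sum_list (take k lam)}"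
proof (induction k)
  case (Suc k)
  then show ?case
    by (auto simp: lessThan_Suc blk_def sum_list_take_Suc)
qed simp

lemma Parts_nth:
  assumes "lam \<in> Parts n q" "i < length lam"
  shows "lam ! i > 0 \<and> lam ! i \<noteq> 1 \<and> lam ! i \<noteq> n"
  using assms(1) nth_mem[OF assms(2)] by (simp add: Parts_def)

lemma blk_nonempty: "lam \<in> Parts n q \<Longrightarrow> i < length lam \<Longrightarrow> blk lam i \<noteq> {}"
  using card_blk[of i lam] Parts_nth[of lam n q i] by auto

lemma blk_inj: "lam \<in> Parts n q \<Longrightarrow> i < length lam \<Longrightarrow> j < length lam \<Longrightarrow> blk lam i = blk lam j \<Longrightarrow> i = j"
  using blk_disjnt[of i j lam] blk_nonempty[of lam n q j] by (auto simp: disjnt_def)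

lemma Union_minface: "lam \<in> Parts n q \<Longrightarrow> \<Union>(minface lam) = {1..n}"
  using UN_blk[of "length lam" lam] by (simp add: minface_def Parts_def)

lemma blk_vless:
  assumes lam: "lam \<in> Parts n q" and ij: "i < j" "j < length lam"
  shows "vless (blk lam i) (blk lam j)"
proof -
  let ?s = "\<lambda>i. sum_list (take i lam)"
  have "lam ! j \<le> lam ! i"
    using lam ij by (intro sorted_rev_nth_mono) (auto simp: Parts_def)
  \<comment> \<open>For blocks of equal size the least elements already decide the lexicographic
    comparison, so the sorted block is displayed with its head split off.\<close>
  moreover have "sorted_list_of_set (blk lam k) = Suc (?s k) # [Suc (Suc (?s k))..<Suc (?s (Suc k))]"
    if "k < length lam" for k
  proof -
    have "lam ! k > 0"
      using Parts_nth[OF lam that] by simp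
    then have "?s k < ?s (Suc k)"
      using that by (simp add: sum_list_take_Suc)
    then show ?thesis
      by (simp add: blk_def atLeastLessThanSuc_atLeastAtMost[symmetric] upt_conv_Cons del: upt_Suc)
  qed
  moreover have "?s i < ?s j"
    using sum_list_take_mono[of "Suc i" j lam] Parts_nth[OF lam, of i] ij sum_list_take_Suc[of i lam] by auto
  ultimately show ?thesis
    using ij by (auto simp: vless_def card_blk)
qed

lemma olist_minface: 
  assumes lam: "lam \<in> Parts n q"
  shows "olist (minface lam) = map (blk lam) [0..<length lam]"
proof -
  have "sorted_wrt vless (map (blk lam) [0..<length lam])"
    using blk_vless[OF lam] by (auto simp: sorted_wrt_map sorted_wrt_iff_nth_less)
  moreover have "set (map (blk lam) [0..<length lam]) = minface lam"
    by (auto simp: minface_def)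
  ultimately show ?thesis
    using olist_eqI by metis
qed

lemma minface_finite: "finite (minface lam)" "\<forall>A\<in>minface lam. finite A"
  by (auto simp: minface_def blk_def)

lemma shape_minface: "lam \<in> Parts n q \<Longrightarrow> shape (minface lam) = lam"
  unfolding shape_def olist_minface by (rule nth_equalityI) (auto simp: card_blk)

lemma big_minface:
  assumes lam: "lam \<in> Parts n q"
  shows "big n q (minface lam)"
proof -
  have "card (minface lam) = length lam"
    unfolding minface_def by (subst card_image) (auto intro!: inj_onI blk_inj[OF lam])
  moreover have "vert n A \<and> card A \<noteq> 1" if A: "A \<in> minface lam" for A
  proof -
    obtain i where i: "i < length lam" "A = blk lam i"
      using A by (auto simp: minface_def)
    have "lam ! i \<noteq> n" "lam ! i \<noteq> 1"
      using Parts_nth[OF lam i(1)] by auto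
    then show ?thesis
      using Union_minface[OF lam] A blk_nonempty[OF lam i(1)] card_blk[OF i(1)] i(2)
      unfolding vert_def by auto
  qed
  moreover have "pairwise disjnt (minface lam)"
    unfolding minface_def by (rule pairwise_imageI) (auto intro: blk_disjnt)
  ultimately show ?thesis
    using lam Union_minface[OF lam] by (simp add: big_def face_def Parts_def)
qed

section \<open>Facets of equal shape form one orbit\<close>

lemma bij_betw_glue:
  assumes f: "\<And>i. i \<in> I \<Longrightarrow> bij_betw (f i) (A i) (B i)"
    and A: "\<And>i j. i \<in> I \<Longrightarrow> j \<in> I \<Longrightarrow> i \<noteq> j \<Longrightarrow> disjnt (A i) (A j)"
    and B: "\<And>i j. i \<in> I \<Longrightarrow> j \<in> I \<Longrightarrow> i \<noteq> j \<Longrightarrow> disjnt (B i) (B j)"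
  obtains g where "bij_betw g (\<Union>i\<in>I. A i) (\<Union>i\<in>I. B i)" "\<And>i. i \<in> I \<Longrightarrow> g ` A i = B i"
proof -
  define g where "g x = f (THE i. i \<in> I \<and> x \<in> A i) x" for x
  have g: "g x = f i x" if "i \<in> I" "x \<in> A i" for i x
  proof -
    have "(THE i. i \<in> I \<and> x \<in> A i) = i"
      using that A by (intro the_equality) (auto simp: disjnt_def)
    then show ?thesis by (simp add: g_def)
  qed
  have im: "g ` A i = B i" if "i \<in> I" for i
    using g[OF that] f[OF that] by (auto simp: bij_betw_def image_iff)
  have "inj_on g (\<Union>i\<in>I. A i)"
  proof (rule inj_onI)
    fix x y assume "x \<in> (\<Union>i\<in>I. A i)" "y \<in> (\<Union>i\<in>I. A i)" and eq: "g x = g y"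
    then obtain i j where ij: "i \<in> I" "x \<in> A i" "j \<in> I" "y \<in> A j" by auto
    then have "g x \<in> B i" "g y \<in> B j"
      using im by auto
    then have "i = j"
      using B[of i j] ij eq by (auto simp: disjnt_def)
    then show "x = y"
      using eq ij g f[of i] by (auto simp: bij_betw_def dest: inj_onD)
  qed
  moreover have "g ` (\<Union>i\<in>I. A i) = (\<Union>i\<in>I. B i)"
    using im by (simp add: image_UN)
  ultimately show ?thesis
    using im that by (simp add: bij_betw_def)
qed

text \<open>Equal shapes mean equal block sizes position by position in the sorted lists, so the
  blocks are matched by bijections, which are then glued.\<close>

lemma facet_orbit:
  assumes lam: "lam \<in> Parts n q" and \<sigma>: "big n q \<sigma>" "shape \<sigma> = lam"
  shows "\<exists>g. g permutes {1..n} \<and> fimage g (minface lam) = \<sigma>"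
proof -
  have f: "face n q \<sigma>" using \<sigma> by (simp add: big_def)
  note fin = face_finite[OF f] face_blocks_finite[OF f]
  let ?L = "olist \<sigma>" and ?I = "{..<length lam}"
  have L: "length ?L = length lam" "set ?L = \<sigma>" "distinct ?L"
    using \<sigma>(2) fin by (auto simp: shape_def set_olist distinct_olist)
  have "\<exists>h. bij_betw h (blk lam i) (?L ! i)" if i: "i \<in> ?I" for i
  proof (rule finite_same_card_bij)
    have "shape \<sigma> ! i = card (?L ! i)"
      using i L(1) by (simp add: shape_def)
    then show "card (blk lam i) = card (?L ! i)"
      using i \<sigma>(2) by (simp add: card_blk)
  qed (use i fin L in \<open>auto simp: blk_def\<close>)
  then obtain h where h: "\<And>i. i \<in> ?I \<Longrightarrow> bij_betw (h i) (blk lam i) (?L ! i)"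
    by metis
  have dL: "disjnt (?L ! i) (?L ! j)" if "i \<in> ?I" "j \<in> ?I" "i \<noteq> j" for i j
  proof -
    have "?L ! i \<in> \<sigma>" "?L ! j \<in> \<sigma>" "?L ! i \<noteq> ?L ! j"
      using that L nth_mem[of i ?L] nth_mem[of j ?L] by (simp_all add: nth_eq_iff_index_eq)
    then show ?thesis
      using f by (simp add: face_def pairwise_def)
  qed
  obtain g where g: "bij_betw g (\<Union>i\<in>?I. blk lam i) (\<Union>i\<in>?I. ?L ! i)"
    "\<And>i. i \<in> ?I \<Longrightarrow> g ` blk lam i = ?L ! i"
    using bij_betw_glue[of ?I h "blk lam" "\<lambda>i. ?L ! i", OF h blk_disjnt dL] by blast
  have "(!) ?L ` ?I = set ?L"
    unfolding set_conv_nth L(1) by auto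
  then have nth: "(!) ?L ` ?I = \<sigma>"
    using L(2) by simp
  have 1: "(\<Union>i\<in>?I. blk lam i) = {1..n}"
    using Union_minface[OF lam] by (simp add: minface_def)
  have 2: "(\<Union>i\<in>?I. ?L ! i) = {1..n}"
    using \<sigma>(1) by (simp add: nth big_def)
  \<comment> \<open>The glued map is arbitrary outside \<open>{1..n}\<close>, where a permutation of
    that set has to be the identity.\<close>
  define g' where "g' x = (if x \<in> {1..n} then g x else x)" for x
  have "bij_betw g' {1..n} {1..n}"
    using g(1) unfolding 1 2 by (subst bij_betw_cong[of _ g' g]) (simp_all add: g'_def)
  then have perm: "g' permutes {1..n}"
    by (rule bij_imp_permutes) (auto simp: g'_def)
  have "g' ` blk lam i = ?L ! i" if "i \<in> ?I" for i
  proof -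
    have "blk lam i \<subseteq> {1..n}" using 1 that by blast
    then have "g' ` blk lam i = g ` blk lam i"
      by (intro image_cong) (auto simp: g'_def)
    then show ?thesis using g(2) that by simp
  qed
  then have "fimage g' (minface lam) = (!) ?L ` ?I"
    unfolding minface_def image_image by (intro image_cong refl)
  then have "fimage g' (minface lam) = \<sigma>"
    using nth by (rule trans)
  with perm show ?thesis by blast
qed

section \<open>The normaliser as stabiliser of the block partition\<close>

lemma Young_iff: "h \<in> Young n lam \<longleftrightarrow> h permutes {1..n} \<and> (\<forall>A\<in>minface lam. h ` A = A)"
  by (auto simp: Young_def minface_def)

lemma conj_Young:
  assumes h: "h permutes {1..n}" "fimage h (minface lam) = minface lam" and y: "y \<in> Young n lam"
  shows "h \<circ> y \<circ> inv h \<in> Young n lam"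
  unfolding Young_iff
proof (intro conjI ballI)
  show "h \<circ> y \<circ> inv h permutes {1..n}"
    using h y permutes_compose permutes_inv by (metis Young_iff)
  fix A assume "A \<in> minface lam"
  then obtain B where B: "B \<in> minface lam" "A = h ` B"
    using h(2) by blast
  have "inv h ` A = B"
    unfolding B(2) using permutes_injective[OF h(1)] by (simp add: image_image)
  then have "(h \<circ> y \<circ> inv h) ` A = h ` y ` B"
    by (metis image_comp)
  also have "\<dots> = A"
    using y B by (simp add: Young_iff)
  finally show "(h \<circ> y \<circ> inv h) ` A = A" .
qed

lemma conj_cancel:
  assumes "h permutes S"
  shows "inv h \<circ> (h \<circ> y \<circ> inv h) \<circ> h = y" "h \<circ> (inv h \<circ> y \<circ> h) \<circ> inv h = y"
  using permutes_inverses[OF assms] by (auto simp: fun_eq_iff)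

lemma fimage_minface_inv:
  assumes "h permutes {1..n}" "fimage h \<sigma> = \<sigma>"
  shows "fimage (inv h) \<sigma> = \<sigma>"
proof -
  have "fimage (inv h) (fimage h \<sigma>) = \<sigma>"
    unfolding fimage_comp[symmetric] permutes_inv_o(2)[OF assms(1)] by simp
  then show ?thesis using assms by simp
qed

text \<open>The blocks are the orbits of the Young subgroup, as witnessed by the transpositions
  it contains; hence its normaliser permutes them.\<close>

lemma Norm_block_subset:
  assumes lam: "lam \<in> Parts n q" and h: "h permutes {1..n}"
    and conj: "\<And>y. y \<in> Young n lam \<Longrightarrow> h \<circ> y \<circ> inv h \<in> Young n lam"
    and A: "A \<in> minface lam" and B: "B \<in> minface lam" and a: "a \<in> A" "h a \<in> B"
  shows "h ` A \<subseteq> B"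
proof
  fix z assume "z \<in> h ` A"
  then obtain b where b: "b \<in> A" "z = h b" by blast
  have dj: "X \<inter> Y = {}" if "X \<in> minface lam" "Y \<in> minface lam" "X \<noteq> Y" for X Y
    using big_minface[OF lam] that by (auto simp: big_def face_def pairwise_def disjnt_def)
  have "transpose a b ` X = X" if "X \<in> minface lam" for X
    by (rule transpose_image_eq) (use dj[OF that A] a b in auto)
  moreover have "transpose a b permutes {1..n}"
    using Union_minface[OF lam] A a b by (intro permutes_swap_id) auto
  ultimately have "h \<circ> transpose a b \<circ> inv h \<in> Young n lam"
    using conj by (simp add: Young_iff)
  then have "(h \<circ> transpose a b \<circ> inv h) ` B = B"
    using B by (simp add: Young_iff)
  moreover have "(h \<circ> transpose a b \<circ> inv h) (h a) = z"
    using permutes_inverses(2)[OF h] b by simp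
  ultimately show "z \<in> B"
    using a(2) by blast
qed

lemma Norm_eq:
  assumes lam: "lam \<in> Parts n q"
  shows "Norm n lam = {h. h permutes {1..n} \<and> fimage h (minface lam) = minface lam}"
proof (intro set_eqI iffI)
  fix h assume "h \<in> {h. h permutes {1..n} \<and> fimage h (minface lam) = minface lam}"
  then have h: "h permutes {1..n}" "fimage h (minface lam) = minface lam" by auto
  have "y \<in> (\<lambda>y. h \<circ> y \<circ> inv h) ` Young n lam" if "y \<in> Young n lam" for y
  proof (rule image_eqI)
    show "y = h \<circ> (inv h \<circ> y \<circ> h) \<circ> inv h"
      by (rule conj_cancel(2)[OF h(1), symmetric])
    show "inv h \<circ> y \<circ> h \<in> Young n lam"
      using conj_Young[OF permutes_inv[OF h(1)] fimage_minface_inv[OF h] that]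
        permutes_inv_inv[OF h(1)] by simp
  qed
  then show "h \<in> Norm n lam"
    using h conj_Young[OF h] by (auto simp: Norm_def)
next
  fix h assume hN: "h \<in> Norm n lam"
  then have h: "h permutes {1..n}" and im: "(\<lambda>y. h \<circ> y \<circ> inv h) ` Young n lam = Young n lam"
    by (auto simp: Norm_def)
  have conj: "h \<circ> y \<circ> inv h \<in> Young n lam" if "y \<in> Young n lam" for y
    using im that by blast
  have conj': "inv h \<circ> y \<circ> inv (inv h) \<in> Young n lam" if y: "y \<in> Young n lam" for y
  proof -
    obtain z where "z \<in> Young n lam" "y = h \<circ> z \<circ> inv h"
      using im y by blast
    then show ?thesis
      using conj_cancel(1)[OF h, of z] permutes_inv_inv[OF h] by simp
  qed
  have sub: "fimage h (minface lam) \<subseteq> minface lam"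
  proof
    fix X assume "X \<in> fimage h (minface lam)"
    then obtain A where A: "A \<in> minface lam" "X = h ` A" by blast
    then obtain a where a: "a \<in> A"
      using blk_nonempty[OF lam] by (fastforce simp: minface_def)
    then have "h a \<in> {1..n}"
      using Union_minface[OF lam] A permutes_in_image[OF h] by auto
    then obtain B where B: "B \<in> minface lam" "h a \<in> B"
      using Union_minface[OF lam] by blast
    \<comment> \<open>The inclusion is obtained for \<open>h\<close> and for its inverse, both of
      which conjugate the Young subgroup into itself; together they show that \<open>A\<close> is
      mapped onto \<open>B\<close>.\<close>
    have "h ` A \<subseteq> B"
      by (rule Norm_block_subset[OF lam h conj A(1) B(1) a B(2)])
    moreover have "inv h ` B \<subseteq> A"
      by (rule Norm_block_subset[OF lam permutes_inv[OF h] conj' B(1) A(1) B(2)])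
        (use a permutes_inverses(2)[OF h] in simp_all)
    then have "h ` inv h ` B \<subseteq> h ` A" by blast
    then have "B \<subseteq> h ` A"
      using permutes_inverses(1)[OF h] by (simp add: image_image)
    ultimately show "X \<in> minface lam"
      using A B by auto
  qed
  have "fimage h (minface lam) = minface lam"
    by (rule endo_inj_surj[OF minface_finite(1) sub])
      (use inj_image_blocks[OF permutes_injective[OF h]] inj_on_subset in blast)
  with h show "h \<in> {h. h permutes {1..n} \<and> fimage h (minface lam) = minface lam}"
    by simp
qed

text \<open>As \<open>h\<close> only permutes the blocks, sorting their images returns the original
  list of blocks; \<open>tperm\<close> and \<open>gbar\<close> then describe the same index.\<close>

lemma eps_minface:
  assumes lam: "lam \<in> Parts n q" and h: "h \<in> Norm n lam"
  shows "eps h (minface lam) = sign (gbar lam h)"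
proof -
  let ?ys = "map ((`) h) (olist (minface lam))"
  have "set ?ys = minface lam"
    using h by (simp add: Norm_eq[OF lam] set_olist minface_finite)
  then have "olist (set ?ys) = map (blk lam) [0..<length lam]"
    by (simp only: olist_minface[OF lam])
  then have "tperm ?ys i = (if i < length lam
      then THE j. j < length lam \<and> map (blk lam) [0..<length lam] ! j = h ` blk lam i else i)" for i
    by (simp add: tperm_def olist_minface[OF lam] del: set_map)
  moreover have "(j < length lam \<and> map (blk lam) [0..<length lam] ! j = h ` blk lam i)
      = (j < length lam \<and> h ` blk lam i = blk lam j)" for i j
    by (cases "j < length lam") (simp_all add: eq_commute[of "blk lam j"])
  ultimately have "tperm ?ys = gbar lam h"
    by (intro ext) (simp only: gbar_def)
  then show ?thesis
    by (simp add: eps_def tsign_def)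
qed

section \<open>The isomorphism with the induced module\<close>

text \<open>For a chain \<open>c\<close>, the value at \<open>g\<close> is the coefficient of
  \<open>act n q (inv g) c\<close> on the minimal face: the map to the coinduced module given by
  Frobenius reciprocity.\<close>

definition phi :: "nat \<Rightarrow> nat list \<Rightarrow> (nat set set \<Rightarrow> int) \<Rightarrow> (nat \<Rightarrow> nat) \<Rightarrow> int" where
  "phi n lam c g = (if g permutes {1..n} then c (fimage g (minface lam)) * eps g (minface lam) else 0)"

lemma eps_minface_comp:
  assumes "g permutes {1..n}" "h permutes {1..n}"
  shows "eps (g \<circ> h) (minface lam) = eps g (fimage h (minface lam)) * eps h (minface lam)"
  using assms permutes_injective by (intro eps_comp minface_finite) auto

lemma phi_Ind:
  assumes lam: "lam \<in> Parts n q"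
  shows "phi n lam c \<in> Ind n lam"
  unfolding Ind_def
proof (intro CollectI conjI allI impI; (elim conjE)?)
  show "g permutes {1..n}" if "phi n lam c g \<noteq> 0" for g
    using that by (auto simp: phi_def split: if_splits)
  fix g h assume g: "g permutes {1..n}" and hN: "h \<in> Norm n lam"
  then have h: "h permutes {1..n}" "fimage h (minface lam) = minface lam"
    by (auto simp: Norm_eq[OF lam])
  have "g \<circ> h permutes {1..n}"
    by (rule permutes_compose[OF h(1) g])
  then show "phi n lam c (g \<circ> h) = sign (gbar lam h) * phi n lam c g"
    using g h eps_minface_comp[OF g h(1), of lam] eps_minface[OF lam hN]
    unfolding phi_def fimage_comp by simp
qed

lemma phi_act:
  assumes c: "c \<in> chains n q" and k: "k permutes {1..n}"
  shows "phi n lam (act n q k c) = ind_act k (phi n lam c)"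
proof
  fix g
  show "phi n lam (act n q k c) g = ind_act k (phi n lam c) g"
  proof (cases "g permutes {1..n}")
    case g: True
    define g' where "g' = inv k \<circ> g"
    have g': "g' permutes {1..n}"
      unfolding g'_def by (rule permutes_compose[OF g permutes_inv[OF k]])
    have eq: "g = k \<circ> g'"
      using permutes_inverses(1)[OF k] by (auto simp: g'_def)
    \<comment> \<open>The sign of \<open>k\<close> enters twice, once through the action on
      \<open>c\<close> and once through the cocycle rule for \<open>k \<circ> g'\<close>, and
      cancels.\<close>
    have "phi n lam (act n q k c) g =
        c (fimage g' (minface lam)) * eps g' (minface lam) * (eps k (fimage g' (minface lam)) * eps k (fimage g' (minface lam)))"
      using g act_coeff[OF c k] unfolding phi_def eq fimage_comp eps_minface_comp[OF k g'] by simp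
    also have "\<dots> = phi n lam c g'"
      using g' by (simp add: phi_def)
    finally show ?thesis
      by (simp add: ind_act_def g'_def)
  next
    case False
    have "\<not> inv k \<circ> g permutes {1..n}"
    proof
      assume "inv k \<circ> g permutes {1..n}"
      then have "k \<circ> (inv k \<circ> g) permutes {1..n}"
        using k permutes_compose by blast
      moreover have "k \<circ> (inv k \<circ> g) = g"
        using permutes_inverses(1)[OF k] by auto
      ultimately show False using False by simp
    qed
    with False show ?thesis
      by (simp add: phi_def ind_act_def)
  qed
qed

text \<open>The translates of the minimal face are exactly the big facets of its shape, and the
  factor \<open>eps\<close> is a unit.\<close>

lemma phi_eq_0_iff:
  assumes lam: "lam \<in> Parts n q"
  shows "phi n lam c = 0 \<longleftrightarrow> (\<forall>\<sigma>. big n q \<sigma> \<and> shape \<sigma> = lam \<longrightarrow> c \<sigma> = 0)"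
proof (intro iffI allI impI; (elim conjE)?)
  fix \<sigma> assume 0: "phi n lam c = 0" and \<sigma>: "big n q \<sigma>" "shape \<sigma> = lam"
  obtain g where g: "g permutes {1..n}" "fimage g (minface lam) = \<sigma>"
    using facet_orbit[OF lam \<sigma>] by blast
  have "phi n lam c g = 0" using 0 by simp
  then have "c \<sigma> * eps g (minface lam) = 0"
    using g by (simp add: phi_def)
  moreover have "eps g (minface lam) \<noteq> 0"
    by (metis eps_square mult_zero_left zero_neq_one)
  ultimately show "c \<sigma> = 0" by simp
next
  assume 0: "\<forall>\<sigma>. big n q \<sigma> \<and> shape \<sigma> = lam \<longrightarrow> c \<sigma> = 0"
  have "c (fimage g (minface lam)) = 0" if g: "g permutes {1..n}" for g
    using 0 big_image[OF g, of q "minface lam"] big_minface[OF lam] shape_minface[OF lam]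
      shape_image[OF minface_finite permutes_injective[OF g], of lam] by simp
  then show "phi n lam c = 0"
    by (auto simp: phi_def fun_eq_iff)
qed

text \<open>Inverts \<open>phi\<close>: the sign is its own inverse, and the choice of
  \<open>g\<close> is harmless when \<open>f\<close> obeys the transformation law of
  \<open>Ind\<close>.\<close>

definition coef :: "nat \<Rightarrow> nat list \<Rightarrow> ((nat \<Rightarrow> nat) \<Rightarrow> int) \<Rightarrow> nat set set \<Rightarrow> int" where
  "coef n lam f \<sigma> = (let g = SOME g. g permutes {1..n} \<and> fimage g (minface lam) = \<sigma>
     in f g * eps g (minface lam))"

lemma phi_coef:
  assumes lam: "lam \<in> Parts n q" and f: "f \<in> Ind n lam"
    and c: "\<And>\<sigma>. big n q \<sigma> \<Longrightarrow> shape \<sigma> = lam \<Longrightarrow> c \<sigma> = coef n lam f \<sigma>"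
  shows "phi n lam c = f"
proof
  fix g
  show "phi n lam c g = f g"
  proof (cases "g permutes {1..n}")
    case False
    then have "f g = 0" using f by (auto simp: Ind_def)
    with False show ?thesis by (simp add: phi_def)
  next
    case g: True
    let ?x = "minface lam"
    let ?\<sigma> = "fimage g ?x"
    define G where "G = (SOME G. G permutes {1..n} \<and> fimage G ?x = ?\<sigma>)"
    have G: "G permutes {1..n}" "fimage G ?x = ?\<sigma>"
      unfolding G_def using someI[of "\<lambda>G. G permutes {1..n} \<and> fimage G ?x = ?\<sigma>" g] g by auto
    \<comment> \<open>The chosen \<open>G\<close> and the given \<open>g\<close> have the same
      translate, so they differ by an element of the normaliser; both \<open>f\<close> and
      \<open>eps\<close> change by its sign.\<close>
    define h where "h = inv G \<circ> g"
    have h: "h permutes {1..n}"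
      unfolding h_def by (rule permutes_compose[OF g permutes_inv[OF G(1)]])
    have "fimage h ?x = fimage (inv G \<circ> G) ?x"
      unfolding h_def fimage_comp G(2) ..
    then have hx: "fimage h ?x = ?x"
      unfolding permutes_inv_o(2)[OF G(1)] by simp
    have hN: "h \<in> Norm n lam"
      using h hx by (simp add: Norm_eq[OF lam])
    have gG: "g = G \<circ> h"
      using permutes_inverses(1)[OF G(1)] by (auto simp: h_def)
    have "big n q ?\<sigma>" "shape ?\<sigma> = lam"
      using big_image[OF g, of q ?x] big_minface[OF lam] shape_minface[OF lam]
        shape_image[OF minface_finite permutes_injective[OF g], of lam] by simp_all
    then have "c ?\<sigma> = f G * eps G ?x"
      using c by (simp add: coef_def G_def)
    moreover have "eps g ?x = eps G ?x * eps h ?x"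
      using eps_minface_comp[OF G(1) h, of lam] gG hx by simp
    moreover have "f g = eps h ?x * f G"
      using f G(1) hN gG eps_minface[OF lam hN] by (auto simp: Ind_def)
    ultimately have "phi n lam c g = f g * (eps G ?x * eps G ?x)"
      using g unfolding phi_def by (simp only: if_True ac_simps)
    then show ?thesis by simp
  qed
qed

section \<open>Coefficient description of the submodules and the isomorphisms\<close>

lemma phi_add: "phi n lam (c + d) = phi n lam c + phi n lam d"
  by (auto simp: phi_def fun_eq_iff ring_distribs)

lemma finite_big: "finite {\<sigma>. big n q \<sigma>}"
  by (rule finite_subset[OF _ finite_faces[of n q]]) (auto simp: big_def faces_def)

text \<open>Replaces the span by a vanishing condition on coefficients, which makes stability under
  the action and the kernel of \<open>phi\<close> immediate.\<close>

lemma Vset_eq: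
  assumes n: "n \<ge> 2" and lam: "lam \<in> Parts n q"
  shows "Vset n lam = {c \<in> cycles n q. \<forall>\<sigma>. big n q \<sigma> \<and> shape \<sigma> \<noteq> lam \<longrightarrow> c \<sigma> = 0}"
proof -
  let ?X = "facets_shape n lam"
  let ?z = "\<lambda>k \<tau>. \<Sum>\<sigma>\<in>?X. k \<sigma> * zeta (olist \<sigma>) \<tau>"
  have q: "length lam - 1 = q" using lam by (simp add: Parts_def)
  have X: "?X = {\<sigma>. big n q \<sigma> \<and> shape \<sigma> = lam}"
    by (rule facets_shape_eq[OF lam])
  have "finite ?X"
    unfolding X by (rule finite_subset[OF _ finite_big[of n q]]) auto
  note z = cycle_prescribed[OF this, where n = n and q = q]
  have zc: "?z k \<in> cycles n q" for k
    by (rule z(1)) (simp add: X)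
  have zb: "?z k \<tau> = (if shape \<tau> = lam then k \<tau> else 0)" if "big n q \<tau>" for k \<tau>
    using z(2)[OF _ that, where k = k] that by (simp add: X)
  show ?thesis
  proof (intro set_eqI iffI)
    fix c assume "c \<in> Vset n lam"
    then obtain k b where c: "c = (\<lambda>\<tau>. ?z k \<tau> + b \<tau>)" and b: "b \<in> bdries n q"
      unfolding Vset_def q by blast
    have "c \<in> cycles n q"
      unfolding c by (rule cycles_add[OF zc bdries_cycles[OF b]])
    moreover have "c \<sigma> = 0" if "big n q \<sigma>" "shape \<sigma> \<noteq> lam" for \<sigma>
      using zb[OF that(1)] that(2) bdries_facet[OF b] that(1) by (simp add: c big_def)
    ultimately show "c \<in> {c \<in> cycles n q. \<forall>\<sigma>. big n q \<sigma> \<and> shape \<sigma> \<noteq> lam \<longrightarrow> c \<sigma> = 0}"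
      by simp
  next
    fix c assume "c \<in> {c \<in> cycles n q. \<forall>\<sigma>. big n q \<sigma> \<and> shape \<sigma> \<noteq> lam \<longrightarrow> c \<sigma> = 0}"
    then have c: "c \<in> cycles n q" "\<And>\<sigma>. big n q \<sigma> \<Longrightarrow> shape \<sigma> \<noteq> lam \<Longrightarrow> c \<sigma> = 0"
      by auto
    \<comment> \<open>The coefficients of \<open>c\<close> itself are used for the combination of
      join cycles; the remainder vanishes on all big facets and is therefore a boundary.\<close>
    define b where "b = (\<lambda>\<tau>. c \<tau> - ?z c \<tau>)"
    have "b \<in> cycles n q"
      unfolding b_def by (rule cycles_diff[OF c(1) zc])
    moreover have "b \<sigma> = 0" if "big n q \<sigma>" for \<sigma>
      using zb[OF that] c(2)[OF that] by (simp add: b_def)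
    ultimately have "b \<in> bdries n q"
      using cycle_bdry_iff[OF n] by blast
    moreover have "c = (\<lambda>\<tau>. ?z c \<tau> + b \<tau>)"
      by (simp add: b_def)
    ultimately show "c \<in> Vset n lam"
      unfolding Vset_def q by blast
  qed
qed

lemma Vset_act:
  assumes n: "n \<ge> 2" and lam: "lam \<in> Parts n q" and g: "g permutes {1..n}" and c: "c \<in> Vset n lam"
  shows "act n q g c \<in> Vset n lam"
proof -
  have cy: "c \<in> cycles n q" and c0: "\<And>\<sigma>. big n q \<sigma> \<Longrightarrow> shape \<sigma> \<noteq> lam \<Longrightarrow> c \<sigma> = 0"
    using c by (auto simp: Vset_eq[OF n lam])
  have "act n q g c \<sigma> = 0" if \<sigma>: "big n q \<sigma>" "shape \<sigma> \<noteq> lam" for \<sigma>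
  proof -
    let ?\<rho> = "fimage (inv g) \<sigma>"
    have f: "face n q \<sigma>" using \<sigma> by (simp add: big_def)
    have g': "inv g permutes {1..n}" by (rule permutes_inv[OF g])
    have "big n q ?\<rho>" "shape ?\<rho> \<noteq> lam"
      using \<sigma> big_image[OF g'] shape_image[OF face_finite[OF f] face_blocks_finite[OF f] permutes_injective[OF g']]
      by simp_all
    then have "act n q g c (fimage g ?\<rho>) = 0"
      using act_coeff[of c n q g ?\<rho>] cy g c0 by (simp add: cycles_eq)
    then show ?thesis
      unfolding fimage_inv[OF g] .
  qed
  then show ?thesis
    using act_cycles[OF cy g] by (simp add: Vset_eq[OF n lam])
qed

lemma Vset_iso:
  assumes n: "n \<ge> 2" and lam: "lam \<in> Parts n q"
  shows "equiv_quot_iso n q (Vset n lam) (bdries n q) (Ind n lam) ind_act (phi n lam)"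
  unfolding equiv_quot_iso_def
proof (intro conjI ballI allI impI; (elim conjE)?)
  note V = Vset_eq[OF n lam]
  show "phi n lam ` Vset n lam = Ind n lam"
  proof
    show "Ind n lam \<subseteq> phi n lam ` Vset n lam"
    proof
      fix f assume f: "f \<in> Ind n lam"
      let ?X = "{\<sigma>. big n q \<sigma> \<and> shape \<sigma> = lam}"
      let ?c = "\<lambda>\<tau>. \<Sum>\<sigma>\<in>?X. coef n lam f \<sigma> * zeta (olist \<sigma>) \<tau>"
      have "finite ?X"
        by (rule finite_subset[OF _ finite_big[of n q]]) auto
      note z = cycle_prescribed[OF this, where n = n and q = q and k = "coef n lam f"]
      show "f \<in> phi n lam ` Vset n lam"
      proof (rule image_eqI)
        show "f = phi n lam ?c"
          by (rule phi_coef[OF lam f, symmetric]) (use z(2) in simp)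
        show "?c \<in> Vset n lam"
          using z by (simp add: V)
      qed
    qed
  qed (use phi_Ind[OF lam] in blast)
  show "phi n lam (c + d) = phi n lam c + phi n lam d" for c d
    by (rule phi_add)
  \<comment> \<open>On \<open>Vset\<close> the coefficients at other shapes vanish already, so
    \<open>phi\<close> tests all big facets.\<close>
  show "phi n lam c = 0 \<longleftrightarrow> c \<in> bdries n q" if "c \<in> Vset n lam" for c
    using that cycle_bdry_iff[OF n, of c q] phi_eq_0_iff[OF lam, of c] by (auto simp: V)
  show "phi n lam (act n q g c) = ind_act g (phi n lam c)" if "g permutes {1..n}" "c \<in> Vset n lam" for g c
    using that by (intro phi_act) (simp_all add: V cycles_eq)
qed

definition psi :: "nat \<Rightarrow> nat \<Rightarrow> (nat set set \<Rightarrow> int) \<Rightarrow> nat list \<Rightarrow> (nat \<Rightarrow> nat) \<Rightarrow> int" where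
  "psi n q c lam = (if lam \<in> Parts n q then phi n lam c else 0)"

text \<open>The shapes partition the big facets, and the component at \<open>lam\<close> sees
  exactly the coefficients of that shape. So the components can be prescribed independently, and
  jointly they see every big facet.\<close>

lemma homology_iso:
  assumes n: "n \<ge> 2"
  shows "equiv_quot_iso n q (cycles n q) (bdries n q) (DSum n q) dsum_act (psi n q)"
  unfolding equiv_quot_iso_def
proof (intro conjI ballI allI impI; (elim conjE)?)
  show "psi n q ` cycles n q = DSum n q"
  proof
    show "psi n q ` cycles n q \<subseteq> DSum n q"
      by (auto simp: DSum_def psi_def phi_Ind fun_eq_iff)
    show "DSum n q \<subseteq> psi n q ` cycles n q"
    proof
      fix F assume F: "F \<in> DSum n q"
      \<comment> \<open>Each big facet takes its coefficient from the component of \<open>F\<close>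
        at its own shape.\<close>
      let ?k = "\<lambda>\<sigma>. coef n (shape \<sigma>) (F (shape \<sigma>)) \<sigma>"
      let ?c = "\<lambda>\<tau>. \<Sum>\<sigma>\<in>{\<sigma>. big n q \<sigma>}. ?k \<sigma> * zeta (olist \<sigma>) \<tau>"
      note z = cycle_prescribed[OF finite_big[of n q], where n = n and q = q and k = ?k]
      have "psi n q ?c lam = F lam" for lam
      proof (cases "lam \<in> Parts n q")
        case True
        then have "phi n lam ?c = F lam"
          using F z(2) by (intro phi_coef[OF True]) (auto simp: DSum_def)
        with True show ?thesis by (simp add: psi_def)
      next
        case False
        then show ?thesis
          using F by (auto simp: psi_def DSum_def fun_eq_iff)
      qed
      then have "F = psi n q ?c" by auto
      moreover have "?c \<in> cycles n q" using z(1) by simp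
      ultimately show "F \<in> psi n q ` cycles n q" by blast
    qed
  qed
  show "psi n q (c + d) = psi n q c + psi n q d" for c d
    by (rule ext) (simp add: psi_def phi_add)
  show "psi n q c = 0 \<longleftrightarrow> c \<in> bdries n q" if c: "c \<in> cycles n q" for c
  proof -
    have "psi n q c = 0 \<longleftrightarrow> (\<forall>lam\<in>Parts n q. phi n lam c = 0)"
      unfolding fun_eq_iff[of "psi n q c"] psi_def by auto
    also have "\<dots> \<longleftrightarrow> (\<forall>\<sigma>. big n q \<sigma> \<longrightarrow> c \<sigma> = 0)"
      using phi_eq_0_iff shape_Parts by blast
    finally show ?thesis
      using cycle_bdry_iff[OF n c] by simp
  qed
  show "psi n q (act n q g c) = dsum_act g (psi n q c)" if "g permutes {1..n}" "c \<in> cycles n q" for g c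
  proof
    fix lam
    show "psi n q (act n q g c) lam = dsum_act g (psi n q c) lam"
      using that phi_act[of c n q g lam]
      by (auto simp: psi_def dsum_act_def cycles_eq) (auto simp: ind_act_def)
  qed
qed

theorem theorem2:
  fixes n q :: nat
  assumes "n \<ge> 2"
  shows "(\<forall>lam\<in>Parts n q.
            Vset n lam \<subseteq> cycles n q \<and>
            (\<forall>g c. g permutes {1..n} \<and> c \<in> Vset n lam \<longrightarrow> act n q g c \<in> Vset n lam) \<and>
            (\<exists>phi. equiv_quot_iso n q (Vset n lam) (bdries n q) (Ind n lam) ind_act phi))
       \<and> (\<exists>psi. equiv_quot_iso n q (cycles n q) (bdries n q) (DSum n q) dsum_act psi)"
proof (intro conjI ballI)
  fix lam assume lam: "lam \<in> Parts n q"
  show "Vset n lam \<subseteq> cycles n q"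
    by (auto simp: Vset_eq[OF assms lam])
  show "\<forall>g c. g permutes {1..n} \<and> c \<in> Vset n lam \<longrightarrow> act n q g c \<in> Vset n lam"
    using Vset_act[OF assms lam] by blast
  show "\<exists>phi. equiv_quot_iso n q (Vset n lam) (bdries n q) (Ind n lam) ind_act phi"
    using Vset_iso[OF assms lam] by blast
next
  show "\<exists>psi. equiv_quot_iso n q (cycles n q) (bdries n q) (DSum n q) dsum_act psi"
    using homology_iso[OF assms] by blast
qed

end
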